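(* (Dual objective convergence) Let $\{\mu_i^k,\mathbf{G}_i^k\}$, $i\in V$, be the dual variables generated by the algorithm CoBa-DD described in the context, with bounded initial values $\mu_i^0,\mathbf{G}_i^0$. Suppose the convexity/compactness, existence and Slater assumptions hold and that $\mathbf{W}$ satisfies the consensus-matrix conditions (all stated in the context). Let $\beta_0\ge c_0$ with $c_0$ as in the context, let $M=L+Q$, choose a scalar $\tau$ with $\beta_0/\alpha\le\tau$, and let $\zeta$ be the scalar associated in the context with the concave function $q$ and the choice of $\tau$. Let $q^*$ be the optimal value of $q$, i.e. $q^*=\sup_{\mu\ge0,\mathbf{G}\succeq0}q(\mu,\mathbf{G})$. Let $\varphi\ge\bar\varphi+\delta$ with $\delta\ge0$ and $$\bar\varphi=\frac{\log(\beta_0)-\log\big(4n(1+d^2)(\beta_0+\alpha M)\big)}{\log(\nu)}.$$ Then the following holds. If $q^*=\infty$, then $\limsup_{k\to\infty}q(\mu_i^k,\mathbf{G}_i^k)=\infty$ for all $i\in V$. If $q^*<\infty$, then $$\limsup_{k\to\infty}q(\mu_i^k,\mathbf{G}_i^k)\ \ge\ q^*-\frac{\alpha n(M+\tau)^2}{2}-n\big(\beta_\infty(9M+3\tau)+\zeta\big),\qquad\forall i\in V,$$ with $\beta_\infty=\frac{p\,\alpha M}{1-p}$ and $p=\frac{\nu^\delta\beta_0}{\beta_0+\alpha M}$.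
   Context: Problem. Let $V=\{1,\dots,n\}$ be the nodes of an undirected time-invariant communication graph, with $N_i$ the set of neighbours of node $i$. For $i\in V$ let $f_i,g_i:\mathbb{R}\to\mathbb{R}$ be convex and $X_i\subset\mathbb{R}$ convex and compact; $X=\prod_{i\in V}X_i$. Let $\mathbf{A}_0,\mathbf{A}_i$ ($i\in V$) be real symmetric $d\times d$ matrices. The problem is $$\min_{x_i\in X_i,\,i\in V} f(\mathbf{x}):=\sum_{i\in V}f_i(x_i)\quad\text{s.t.}\quad \sum_{i\in V}g_i(x_i)\le 0,\quad \mathbf{A}_0+\sum_{i\in V}\mathbf{A}_ix_i\succeq 0.$$ Existence assumption: the feasible set $F$ is nonempty, $f(\mathbf{x})>-\infty$ for all $\mathbf{x}\in F$, and $f(\mathbf{x})<\infty$ for some $\mathbf{x}\in F$. Slater assumption: there is $\bar{\mathbf{x}}\in X$ with $\sum_i g_i(\bar x_i)<0$ and $\mathbf{A}_0+\sum_i\mathbf{A}_i\bar x_i\succ0$. Dual. $\mathbb{S}^d_+$ is the cone of positive semidefinite $d\times d$ matrices. For $\mu\in\mathbb{R}_+$, $\mathbf{G}\in\mathbb{S}_+^d$, let $L_i(x_i,\mu,\mathbf{G})=f_i(x_i)+\mu g_i(x_i)-\mathrm{tr}[(\mathbf{A}_0/n+\mathbf{A}_ix_i)\mathbf{G}]$, $q_i(\mu,\mathbf{G})=\min_{x_i\in X_i}L_i(x_i,\mu,\mathbf{G})$, $q=\sum_{i\in V}q_i$. Let $L=\max_{i\in V}\max_{x_i\in X_i}|g_i(x_i)|$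 and $Q=\max_{i\in V}\max_{x_i\in X_i}\|-\mathbf{A}_0/n-\mathbf{A}_ix_i\|_{\mathrm F}$. Consensus-matrix conditions. $\mathbf{W}\in\mathbb{R}^{n\times n}$ satisfies $[\mathbf{W}]_{ij}=0$ if $j\notin N_i\cup\{i\}$, $\mathbf{W}=\mathbf{W}^{\mathsf T}$, $\mathbf{W}\mathbf{1}_n=\mathbf{1}_n$ (with $\mathbf{1}_n$ the all-ones column vector), and the spectral radius of $\mathbf{W}-\mathbf{1}_n\mathbf{1}_n^{\mathsf T}/n$ is at most $\nu$, where $\nu<1$ (and $\nu>0$). Algorithm CoBa-DD. Fix $\alpha>0$, a number $\varphi\in\mathbb{N}$ of consensus steps, a Slater vector $\bar{\mathbf{x}}$, some $\tilde\mu\ge0,\tilde{\mathbf{G}}\succeq0$, set $\gamma=\min\{-\sum_i g_i(\bar x_i),\ \lambda_{\min}(\mathbf{A}_0+\sum_i\mathbf{A}_i\bar x_i)\}$ with $\lambda_{\min}$ the smallest eigenvalue, choose $r\ge (f(\bar{\mathbf{x}})-q(\tilde\mu,\tilde{\mathbf{G}}))/\gamma$, $r>0$, and let $D_\mu=\{\mu\ge0:|\mu|\le (f(\bar{\mathbf{x}})-q(\tilde\mu,\tilde{\mathbf{G}}))/\gamma+r\}$, $D_{\mathbf{G}}=\{\mathbf{G}\succeq0:\|\mathbf{G}\|_{\mathrm F}\le (f(\bar{\mathbf{x}})-q(\tilde\mu,\tilde{\mathbf{G}}))/\gamma+r\}$. Start from $\mu_i^0\in\mathbb{R}_+$, $\mathbf{G}_i^0\in\mathbb{S}_+^d$.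 For $k\ge0$ pick $\tilde x_i^k\in\mathrm{argmin}_{x_i\in X_i}L_i(x_i,\mu_i^k,\mathbf{G}_i^k)$, and update, with $\mathsf{P}_D$ the Euclidean (Frobenius) projection onto $D$, $$\mu_i^{k+1}=\mathsf{P}_{D_\mu}\Big[\sum_{j\in V}[\mathbf{W}^\varphi]_{ij}(\mu_j^k+\alpha g_j(\tilde x_j^k))\Big],\quad \mathbf{G}_i^{k+1}=\mathsf{P}_{D_{\mathbf{G}}}\Big[\sum_{j\in V}[\mathbf{W}^\varphi]_{ij}\big(\mathbf{G}_j^k-\alpha(\mathbf{A}_0/n+\mathbf{A}_j\tilde x_j^k)\big)\Big].$$ Constant $c_0$. $c_0\ge0$ is a number such that for all $i\in V$ $$\Big\|\sum_{j\in V}[\mathbf{W}^\varphi-\mathbf{1}_n\mathbf{1}_n^{\mathsf T}/n]_{ij}(\mu_j^0+\alpha g_j(\tilde x_j^0))\Big\|_2+\Big\|\sum_{j\in V}[\mathbf{W}^\varphi-\mathbf{1}_n\mathbf{1}_n^{\mathsf T}/n]_{ij}\big(\mathbf{G}_j^0-\alpha(\mathbf{A}_0/n+\mathbf{A}_j\tilde x_j^0)\big)\Big\|_{\mathrm F}\le c_0.$$ It is understood that $\beta_0>0$ and $M>0$, so that the logarithms and $1/(1-p)$ are defined. Scalar $\zeta$. Let $Z=\{(\mu,\mathrm{vec}(\mathbf{G})^{\mathsf T})^{\mathsf T}\in\mathbb{R}^{1+d^2}:\mu\in D_\mu,\mathbf{G}\in D_{\mathbf{G}}\}$ (convex, compact)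 and write $q(\mathbf{z})=q(\mu,\mathbf{G})$ for $\mathbf{z}=(\mu,\mathrm{vec}(\mathbf{G})^{\mathsf T})^{\mathsf T}$; $q$ is concave. For $\epsilon\ge0$, $\partial_\epsilon q(\mathbf{z}')$ is the set of vectors $\mathbf{g}$ with $\langle\mathbf{g},\mathbf{y}-\mathbf{z}'\rangle\ge q(\mathbf{y})-q(\mathbf{z}')-\epsilon$ for all $\mathbf{y}\in Z$; $\partial q=\partial_0 q$. Given $\tau$, $\zeta>0$ is a finite scalar such that for all $\mathbf{z}\in Z$, all $\mathbf{g}\in\partial q(\mathbf{z})$ and all vectors $\boldsymbol{\nu}\in\mathbb{R}^{1+d^2}$ with $\|\boldsymbol{\nu}\|_2\le\tau$, one has $\mathbf{g}+\boldsymbol{\nu}\in\partial_\zeta q(\mathbf{z})$. *)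

theory Defs
  imports "HOL-Analysis.Analysis"
begin

text \<open>
  The nodes are the elements of a finite type \<open>'v\<close>, so \<open>n = CARD('v)\<close>; a \<open>d \<times> d\<close> matrix has type
  \<open>real^'d^'d\<close>, whose library norm is the Frobenius norm and whose library inner product is
  \<open>tr (A\<^sup>T B)\<close>.
\<close>

definition symmetric :: "real^'d^'d \<Rightarrow> bool" where
  "symmetric A \<longleftrightarrow> transpose A = A"

definition psd :: "(real^'d^'d) \<Rightarrow> bool" where
  "psd A \<longleftrightarrow> symmetric A \<and> (\<forall>v. 0 \<le> v \<bullet> (A *v v))"

definition pos_def :: "(real^'d^'d) \<Rightarrow> bool" where
  "pos_def A \<longleftrightarrow> symmetric A \<and> (\<forall>v. v \<noteq> 0 \<longrightarrow> 0 < v \<bullet> (A *v v))"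

definition lambda_min :: "real^'d^'d \<Rightarrow> real" where
  "lambda_min A = (LEAST l. \<exists>v. v \<noteq> 0 \<and> A *v v = l *\<^sub>R v)"

definition spectral_radius :: "real^'d^'d \<Rightarrow> real" where
  "spectral_radius A =
     Sup {cmod l | l. \<exists>v :: complex^'d. v \<noteq> 0 \<and> map_matrix complex_of_real A *v v = l *s v}"

text \<open>The operator \<open>^\<close> on \<open>real^'d^'d\<close> is the entrywise power; this is the power for \<open>**\<close>.\<close>

primrec matpow :: "real^'d^'d \<Rightarrow> nat \<Rightarrow> real^'d^'d" where
  "matpow A 0 = mat 1"
| "matpow A (Suc k) = A ** matpow A k"

text \<open>\<open>1\<^sub>n 1\<^sub>n\<^sup>T / n\<close>\<close>

definition avg_matrix :: "real^'v^'v" where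
  "avg_matrix = (\<chi> i j. 1 / real CARD('v))"

text \<open>
  \<open>E\<close> is the adjacency relation of the communication graph. The vector \<open>1 :: real^'v\<close> is the
  all-ones vector.
\<close>

definition consensus_matrix :: "('v \<Rightarrow> 'v \<Rightarrow> bool) \<Rightarrow> real \<Rightarrow> real^'v^'v \<Rightarrow> bool" where
  "consensus_matrix E \<nu> W \<longleftrightarrow>
     (\<forall>i j. j \<notin> {k. E i k} \<union> {i} \<longrightarrow> W $ i $ j = 0) \<and>
     W = transpose W \<and>
     W *v 1 = 1 \<and>
     spectral_radius (W - avg_matrix) \<le> \<nu>"

definition objective :: "('v::finite \<Rightarrow> real \<Rightarrow> real) \<Rightarrow> ('v \<Rightarrow> real) \<Rightarrow> real" where
  "objective f x = (\<Sum>i\<in>UNIV. f i (x i))"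

definition lmi :: "real^'d^'d \<Rightarrow> ('v::finite \<Rightarrow> real^'d^'d) \<Rightarrow> ('v \<Rightarrow> real) \<Rightarrow> real^'d^'d" where
  "lmi A0 A x = A0 + (\<Sum>i\<in>UNIV. x i *\<^sub>R A i)"

definition feasible_set ::
  "('v::finite \<Rightarrow> real \<Rightarrow> real) \<Rightarrow> ('v \<Rightarrow> real set) \<Rightarrow> real^'d^'d \<Rightarrow> ('v \<Rightarrow> real^'d^'d) \<Rightarrow>
   ('v \<Rightarrow> real) set" where
  "feasible_set g X A0 A =
     {x. (\<forall>i. x i \<in> X i) \<and> (\<Sum>i\<in>UNIV. g i (x i)) \<le> 0 \<and> psd (lmi A0 A x)}"

text \<open>As the objective is real-valued, the last two conjuncts always follow from the first.\<close>

definition existence_assumption ::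
  "('v::finite \<Rightarrow> real \<Rightarrow> real) \<Rightarrow> ('v \<Rightarrow> real \<Rightarrow> real) \<Rightarrow> ('v \<Rightarrow> real set) \<Rightarrow>
   real^'d^'d \<Rightarrow> ('v \<Rightarrow> real^'d^'d) \<Rightarrow> bool" where
  "existence_assumption f g X A0 A \<longleftrightarrow>
     feasible_set g X A0 A \<noteq> {} \<and>
     (\<forall>x\<in>feasible_set g X A0 A. - \<infinity> < ereal (objective f x)) \<and>
     (\<exists>x\<in>feasible_set g X A0 A. ereal (objective f x) < \<infinity>)"

definition slater_vector ::
  "('v::finite \<Rightarrow> real \<Rightarrow> real) \<Rightarrow> ('v \<Rightarrow> real set) \<Rightarrow> real^'d^'d \<Rightarrow> ('v \<Rightarrow> real^'d^'d) \<Rightarrow>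
   ('v \<Rightarrow> real) \<Rightarrow> bool" where
  "slater_vector g X A0 A x \<longleftrightarrow>
     (\<forall>i. x i \<in> X i) \<and> (\<Sum>i\<in>UNIV. g i (x i)) < 0 \<and> pos_def (lmi A0 A x)"

definition local_lmi ::
  "real^'d^'d \<Rightarrow> ('v::finite \<Rightarrow> real^'d^'d) \<Rightarrow> 'v \<Rightarrow> real \<Rightarrow> real^'d^'d" where
  "local_lmi A0 A i x = (1 / real CARD('v)) *\<^sub>R A0 + x *\<^sub>R A i"

definition lagrangian ::
  "('v::finite \<Rightarrow> real \<Rightarrow> real) \<Rightarrow> ('v \<Rightarrow> real \<Rightarrow> real) \<Rightarrow> real^'d^'d \<Rightarrow> ('v \<Rightarrow> real^'d^'d) \<Rightarrow>
   'v \<Rightarrow> real \<Rightarrow> real \<Rightarrow> real^'d^'d \<Rightarrow> real" where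
  "lagrangian f g A0 A i x \<mu> G = f i x + \<mu> * g i x - trace (local_lmi A0 A i x ** G)"

text \<open>
  The infima and suprema over \<open>X i\<close> below are attained when \<open>X i\<close> is nonempty and compact and
  \<open>f i\<close>, \<open>g i\<close> are convex on the real line, hence continuous.
\<close>

definition local_dual ::
  "('v::finite \<Rightarrow> real \<Rightarrow> real) \<Rightarrow> ('v \<Rightarrow> real \<Rightarrow> real) \<Rightarrow> ('v \<Rightarrow> real set) \<Rightarrow>
   real^'d^'d \<Rightarrow> ('v \<Rightarrow> real^'d^'d) \<Rightarrow> 'v \<Rightarrow> real \<Rightarrow> real^'d^'d \<Rightarrow> real" where
  "local_dual f g X A0 A i \<mu> G = (INF x\<in>X i. lagrangian f g A0 A i x \<mu> G)"

definition dual ::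
  "('v::finite \<Rightarrow> real \<Rightarrow> real) \<Rightarrow> ('v \<Rightarrow> real \<Rightarrow> real) \<Rightarrow> ('v \<Rightarrow> real set) \<Rightarrow>
   real^'d^'d \<Rightarrow> ('v \<Rightarrow> real^'d^'d) \<Rightarrow> real \<Rightarrow> real^'d^'d \<Rightarrow> real" where
  "dual f g X A0 A \<mu> G = (\<Sum>i\<in>UNIV. local_dual f g X A0 A i \<mu> G)"

definition dual_opt ::
  "('v::finite \<Rightarrow> real \<Rightarrow> real) \<Rightarrow> ('v \<Rightarrow> real \<Rightarrow> real) \<Rightarrow> ('v \<Rightarrow> real set) \<Rightarrow>
   real^'d^'d \<Rightarrow> ('v \<Rightarrow> real^'d^'d) \<Rightarrow> ereal" where
  "dual_opt f g X A0 A = (SUP (\<mu>, G) \<in> {0..} \<times> {G. psd G}. ereal (dual f g X A0 A \<mu> G))"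

definition bound_L :: "('v::finite \<Rightarrow> real \<Rightarrow> real) \<Rightarrow> ('v \<Rightarrow> real set) \<Rightarrow> real" where
  "bound_L g X = (MAX i. SUP x\<in>X i. \<bar>g i x\<bar>)"

definition bound_Q ::
  "real^'d^'d \<Rightarrow> ('v::finite \<Rightarrow> real^'d^'d) \<Rightarrow> ('v \<Rightarrow> real set) \<Rightarrow> real" where
  "bound_Q A0 A X = (MAX i. SUP x\<in>X i. norm (- local_lmi A0 A i x))"

text \<open>
  These are supergradients, relative to \<open>Z\<close>, of a concave function. A vector \<open>(\<mu>, vec G)\<close> in
  dimension \<open>1 + d\<^sup>2\<close> is represented by the pair \<open>(\<mu>, G) :: real \<times> real^'d^'d\<close>; the library inner
  product and norm of the product type are the Euclidean ones of the stacked vector.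
\<close>

definition eps_subdiff :: "real \<Rightarrow> 'a::real_inner set \<Rightarrow> ('a \<Rightarrow> real) \<Rightarrow> 'a \<Rightarrow> 'a set" where
  "eps_subdiff \<epsilon> Z q z = {s. \<forall>y\<in>Z. s \<bullet> (y - z) \<ge> q y - q z - \<epsilon>}"

definition perturbation_scalar ::
  "'a::real_inner set \<Rightarrow> ('a \<Rightarrow> real) \<Rightarrow> real \<Rightarrow> real \<Rightarrow> bool" where
  "perturbation_scalar Z q \<tau> \<zeta> \<longleftrightarrow>
     0 < \<zeta> \<and>
     (\<forall>z\<in>Z. \<forall>s\<in>eps_subdiff 0 Z q z. \<forall>v. norm v \<le> \<tau> \<longrightarrow> s + v \<in> eps_subdiff \<zeta> Z q z)"

text \<open>
  \<open>\<mu> k i\<close>, \<open>G k i\<close> and \<open>xt k i\<close> are the iterates of node \<open>i\<close> at time \<open>k\<close>. The predicate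
  constrains a run without fixing how ties in the minimisation are resolved.
\<close>

definition coba_dd ::
  "('v::finite \<Rightarrow> real \<Rightarrow> real) \<Rightarrow> ('v \<Rightarrow> real \<Rightarrow> real) \<Rightarrow> ('v \<Rightarrow> real set) \<Rightarrow>
   real^'d^'d \<Rightarrow> ('v \<Rightarrow> real^'d^'d) \<Rightarrow> real^'v^'v \<Rightarrow> nat \<Rightarrow> real \<Rightarrow>
   real set \<Rightarrow> (real^'d^'d) set \<Rightarrow>
   (nat \<Rightarrow> 'v \<Rightarrow> real) \<Rightarrow> (nat \<Rightarrow> 'v \<Rightarrow> real^'d^'d) \<Rightarrow> (nat \<Rightarrow> 'v \<Rightarrow> real) \<Rightarrow> bool" where
  "coba_dd f g X A0 A W \<phi> \<alpha> D\<^sub>\<mu> D\<^sub>G \<mu> G xt \<longleftrightarrow>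
     (\<forall>i. 0 \<le> \<mu> 0 i \<and> psd (G 0 i)) \<and>
     (\<forall>k i. is_arg_min (\<lambda>x. lagrangian f g A0 A i x (\<mu> k i) (G k i)) (\<lambda>x. x \<in> X i) (xt k i)) \<and>
     (\<forall>k i. \<mu> (Suc k) i =
        closest_point D\<^sub>\<mu>
          (\<Sum>j\<in>UNIV. matpow W \<phi> $ i $ j * (\<mu> k j + \<alpha> * g j (xt k j)))) \<and>
     (\<forall>k i. G (Suc k) i =
        closest_point D\<^sub>G
          (\<Sum>j\<in>UNIV. matpow W \<phi> $ i $ j *\<^sub>R (G k j - \<alpha> *\<^sub>R local_lmi A0 A j (xt k j))))"

end

theory Submission
  imports Defs
begin

text \<open>
  Stack the dual variables into \<open>z\<^sub>i = (\<mu>\<^sub>i, G\<^sub>i)\<close>. Every comparison point \<open>z\<^sup>*\<close> of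
  \<open>D\<^sub>\<mu> \<times> D\<^sub>G\<close> gives a Lyapunov function \<open>\<Sum>\<^sub>i \<parallel>z\<^sub>i - z\<^sup>*\<parallel>\<^sup>2\<close>: mixing by \<open>W\<^sup>\<phi>\<close> and projecting do
  not increase it, and a supergradient step decreases it by \<open>2 \<alpha> (q(z\<^sup>*) - \<Sum>\<^sub>j q\<^sub>j(z\<^sub>j))\<close> up to
  \<open>n \<alpha>\<^sup>2 M\<^sup>2\<close>. Each \<open>q\<^sub>j(z\<^sub>j)\<close> may be replaced by \<open>q\<^sub>j(z\<^sub>i)\<close> at the price of \<open>M \<parallel>z\<^sub>i - z\<^sub>j\<parallel>\<close>,
  and the disagreement before projection obeys \<open>b\<^sub>k\<^sub>+\<^sub>1 = p (b\<^sub>k + \<alpha> M)\<close>, whose limit is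
  \<open>\<beta>\<^sub>\<infinity>\<close>. By Slater's condition no dual point outside \<open>D\<^sub>\<mu> \<times> D\<^sub>G\<close> beats \<open>q(\<mu>', G')\<close>, and
  weak duality makes \<open>q\<^sup>*\<close> finite.
\<close>

section \<open>Positive semidefinite matrices: Cauchy-Schwarz, trace and Frobenius norm\<close>

lemma symmetric_inner_commute:
  assumes "symmetric A"
  shows "v \<bullet> (A *v w) = w \<bullet> (A *v v)"
proof -
  have "(A *v v) \<bullet> w = (transpose A *v v) \<bullet> w" using assms by (simp add: symmetric_def)
  also have "\<dots> = v \<bullet> (A *v w)" by (metis dot_lmul_matrix transpose_matrix_vector)
  finally show ?thesis by (simp add: inner_commute)
qed

lemma symmetric_component:
  assumes "symmetric A"
  shows "A $ i $ j = A $ j $ i"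
proof -
  have "transpose A $ i $ j = A $ j $ i" by (simp add: transpose_def)
  then show ?thesis using assms by (simp add: symmetric_def)
qed

lemma axis_inner_mult_axis:
  fixes A :: "real^'d^'d"
  shows "axis i 1 \<bullet> (A *v axis j 1) = A $ i $ j"
  by (simp add: inner_axis' matrix_vector_mult_basis column_def)

text \<open>The form at \<open>w + t *\<^sub>R v\<close> is a quadratic in \<open>t\<close> that is
  never negative, which bounds its discriminant.\<close>

lemma psd_Cauchy_Schwarz:
  assumes "psd A"
  shows "(w \<bullet> (A *v v))\<^sup>2 \<le> (w \<bullet> (A *v w)) * (v \<bullet> (A *v v))"
proof -
  let ?a = "w \<bullet> (A *v w)" and ?b = "w \<bullet> (A *v v)" and ?c = "v \<bullet> (A *v v)"
  have sym: "symmetric A" and nonneg: "\<And>u. 0 \<le> u \<bullet> (A *v u)"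
    using assms by (auto simp: psd_def)
  have quad: "0 \<le> ?a + 2 * t * ?b + t\<^sup>2 * ?c" for t
  proof -
    have "(w + t *\<^sub>R v) \<bullet> (A *v (w + t *\<^sub>R v)) = ?a + 2 * t * ?b + t\<^sup>2 * ?c"
      using symmetric_inner_commute[OF sym, of v w]
      by (simp add: matrix_vector_right_distrib matrix_vector_mult_scaleR inner_simps
          algebra_simps power2_eq_square)
    then show ?thesis using nonneg by metis
  qed
  show ?thesis
  proof (cases "?c = 0")
    case True
    have "?b = 0"
    proof (rule ccontr)
      assume b: "?b \<noteq> 0"
      \<comment> \<open>With \<open>?c = 0\<close> the quadratic is affine in \<open>t\<close>; this
        \<open>t\<close> gives it the value -1.\<close>
      show False using quad[of "- (?a + 1) / (2 * ?b)"] b True by (simp add: field_simps)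
    qed
    then show ?thesis using True by simp
  next
    case False
    then have "0 < ?c" using nonneg[of v] by simp
    \<comment> \<open>This \<open>t\<close> is the minimiser of the quadratic.\<close>
    then show ?thesis using quad[of "- ?b / ?c"]
      by (simp add: field_simps power2_eq_square)
  qed
qed

lemma psd_diag_nonneg: "psd A \<Longrightarrow> 0 \<le> A $ i $ i"
  by (metis axis_inner_mult_axis psd_def)

lemma psd_component_square_le: "psd A \<Longrightarrow> (A $ i $ j)\<^sup>2 \<le> A $ i $ i * A $ j $ j"
  using psd_Cauchy_Schwarz[of A "axis i 1" "axis j 1"] by (simp add: axis_inner_mult_axis)

lemma psd_trace_nonneg: "psd A \<Longrightarrow> 0 \<le> trace A"
  by (simp add: trace_def sum_nonneg psd_diag_nonneg)

lemma norm_square_matrix: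
  fixes A :: "real^'m^'n"
  shows "(norm A)\<^sup>2 = (\<Sum>i\<in>UNIV. \<Sum>j\<in>UNIV. (A $ i $ j)\<^sup>2)"
  unfolding power2_norm_eq_inner by (simp add: inner_vec_def power2_eq_square)

text \<open>Slater's condition bounds the trace of a dual matrix, while \<open>D\<^sub>G\<close> is
  cut out by the Frobenius norm; this links the two. The 2 x 2 principal minors bound each squared
  entry by a product of diagonal entries, and these products add up to the squared trace.\<close>

lemma psd_norm_le_trace:
  assumes "psd A"
  shows "norm A \<le> trace A"
proof -
  have "(norm A)\<^sup>2 \<le> (\<Sum>i\<in>UNIV. \<Sum>j\<in>UNIV. A $ i $ i * A $ j $ j)"
    unfolding norm_square_matrix by (intro sum_mono psd_component_square_le assms)
  also have "\<dots> = (trace A)\<^sup>2"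
    by (simp add: trace_def power2_eq_square sum_product)
  finally show ?thesis using psd_trace_nonneg[OF assms] power2_le_imp_le by blast
qed

lemma trace_mult_eq_inner:
  assumes "symmetric A"
  shows "trace (A ** B) = A \<bullet> B"
proof -
  have "trace (A ** B) = (\<Sum>i\<in>UNIV. \<Sum>k\<in>UNIV. A $ k $ i * B $ k $ i)"
    unfolding trace_def matrix_matrix_mult_def
    by (simp add: symmetric_component[OF assms])
  also have "\<dots> = (\<Sum>k\<in>UNIV. \<Sum>i\<in>UNIV. A $ k $ i * B $ k $ i)" by (rule sum.swap)
  also have "\<dots> = A \<bullet> B" by (simp add: inner_vec_def)
  finally show ?thesis .
qed

text \<open>Cholesky-type elimination: subtracting a rank-one matrix clears one row and column of \<open>G\<close>
  and keeps it positive semidefinite.\<close>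

lemma psd_trace_mult_nonneg:
  fixes P G :: "real^'d^'d"
  assumes P: "psd P" and "psd G"
  shows "0 \<le> trace (P ** G)"
  using \<open>psd G\<close>
proof (induction "card {i. G $ i $ i \<noteq> 0}" arbitrary: G rule: less_induct)
  case less
  show ?case
  proof (cases "\<exists>i. G $ i $ i \<noteq> 0")
    case False
    then have "(G $ i $ j)\<^sup>2 \<le> 0" for i j
      using psd_component_square_le[OF less.prems, of i j] by simp
    then have "G = 0" by (simp add: vec_eq_iff)
    then show ?thesis by (simp add: trace_def)
  next
    case True
    then obtain i where i: "G $ i $ i \<noteq> 0" by blast
    have pos: "0 < G $ i $ i" using psd_diag_nonneg[OF less.prems, of i] i by simp
    have sym: "symmetric G" using less.prems by (simp add: psd_def)
    define u where "u = G $ i"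
    define U :: "real^'d^'d" where "U = (\<chi> a b. u $ a * u $ b)"
    define H where "H = G - (1 / G $ i $ i) *\<^sub>R U"
    have form_U: "v \<bullet> (U *v v) = (u \<bullet> v)\<^sup>2" for v
      unfolding U_def
      by (simp add: inner_vec_def matrix_vector_mult_def power2_eq_square sum_product
          sum_distrib_left mult_ac)
    have form_u: "u \<bullet> v = axis i 1 \<bullet> (G *v v)" for v
      by (simp add: inner_axis' u_def matrix_vector_mul_component)
    have "psd H"
      unfolding psd_def
    proof (intro conjI allI)
      show "symmetric H"
        using sym unfolding symmetric_def H_def U_def
        by (simp add: vec_eq_iff transpose_def mult.commute)
      fix v
      \<comment> \<open>Cauchy-Schwarz against the i-th unit vector is exactly nonnegativity of the
        form of \<open>H\<close>.\<close>
      have "(u \<bullet> v)\<^sup>2 \<le> G $ i $ i * (v \<bullet> (G *v v))"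
        using psd_Cauchy_Schwarz[OF less.prems, of "axis i 1" v]
        by (simp add: form_u axis_inner_mult_axis)
      then show "0 \<le> v \<bullet> (H *v v)"
        unfolding H_def using pos
        by (simp add: matrix_vector_mult_diff_rdistrib scaleR_matrix_vector_assoc[symmetric]
            inner_diff_right form_U field_simps)
    qed
    moreover have "card {j. H $ j $ j \<noteq> 0} < card {j. G $ j $ j \<noteq> 0}"
    proof (rule psubset_card_mono)
      have "H $ i $ i = 0" using i by (simp add: H_def U_def u_def)
      \<comment> \<open>A zero diagonal entry of \<open>G\<close> forces
        \<open>G $ i $ j = 0\<close>, so the rank-one correction does not touch it and the induction
        measure drops.\<close>
      moreover have "H $ j $ j = 0" if "G $ j $ j = 0" for j
        using psd_component_square_le[OF less.prems, of i j] that by (simp add: H_def U_def u_def)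
      ultimately show "{j. H $ j $ j \<noteq> 0} \<subset> {j. G $ j $ j \<noteq> 0}" using i by blast
    qed simp
    ultimately have "0 \<le> trace (P ** H)" using less.hyps by blast
    moreover have "G = H + (1 / G $ i $ i) *\<^sub>R U" by (simp add: H_def)
    moreover have "symmetric P" using P by (simp add: psd_def)
    moreover have "P \<bullet> U = u \<bullet> (P *v u)"
      unfolding U_def
      by (simp add: inner_vec_def matrix_vector_mult_def sum_distrib_left mult_ac)
    moreover have "0 \<le> u \<bullet> (P *v u)" using P by (simp add: psd_def)
    ultimately show ?thesis using pos
      by (metis (no_types, lifting) add_nonneg_nonneg divide_nonneg_pos inner_add_right
          inner_scaleR_right mult_nonneg_nonneg trace_mult_eq_inner zero_le_one)
  qed
qed

section \<open>Extremal eigenvalues and the spectral radius\<close>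

text \<open>The form attains its minimum \<open>l\<close> on the compact unit sphere at some
  \<open>v\<close>. Then \<open>A - l *\<^sub>R mat 1\<close> is positive semidefinite with zero
  form at \<open>v\<close>, and Cauchy-Schwarz forces it to annihilate \<open>v\<close>.\<close>

lemma symmetric_least_eigenvalue:
  fixes A :: "real^'d^'d"
  assumes sym: "symmetric A"
  obtains v l where "v \<noteq> 0" "A *v v = l *\<^sub>R v" "\<And>w. l * (norm w)\<^sup>2 \<le> w \<bullet> (A *v w)"
proof -
  have "continuous_on (sphere 0 1) (\<lambda>w. w \<bullet> (A *v w))"
    by (intro continuous_intros linear_continuous_on_compose[OF continuous_on_id]) simp_all
  moreover have "sphere (0 :: real^'d) 1 \<noteq> {}" by simp
  ultimately obtain v where v: "norm v = 1"
    and min: "\<And>w. norm w = 1 \<Longrightarrow> v \<bullet> (A *v v) \<le> w \<bullet> (A *v w)"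
    using continuous_attains_inf[of "sphere (0 :: real^'d) 1" "\<lambda>w. w \<bullet> (A *v w)"] by auto
  define l where "l = v \<bullet> (A *v v)"
  define B where "B = A - l *\<^sub>R mat 1"
  have B: "B *v w = A *v w - l *\<^sub>R w" for w
    by (simp add: B_def matrix_vector_mult_diff_rdistrib scaleR_matrix_vector_assoc[symmetric])
  have bound: "l * (norm w)\<^sup>2 \<le> w \<bullet> (A *v w)" for w
  proof (cases "w = 0")
    case False
    define u where "u = (1 / norm w) *\<^sub>R w"
    have "l \<le> u \<bullet> (A *v u)"
      unfolding l_def using False by (intro min) (simp add: u_def)
    then have "l \<le> (1 / norm w) * ((1 / norm w) * (w \<bullet> (A *v w)))"
      by (simp add: u_def matrix_vector_mult_scaleR)
    then show ?thesis using False
      by (simp add: field_simps power2_eq_square)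
  qed simp
  have "psd B"
    unfolding psd_def
  proof (intro conjI allI)
    show "symmetric B"
      using sym unfolding symmetric_def B_def by (simp add: vec_eq_iff transpose_def mat_def)
    show "0 \<le> w \<bullet> (B *v w)" for w
      using bound[of w] by (simp add: B inner_diff_right power2_norm_eq_inner)
  qed
  moreover have "v \<bullet> (B *v v) = 0"
    using v by (simp add: B inner_diff_right power2_norm_eq_inner[symmetric] l_def)
  ultimately have "w \<bullet> (B *v v) = 0" for w
    using psd_Cauchy_Schwarz[of B w v] by simp
  then have "B *v v = 0" by (metis inner_eq_zero_iff)
  then have "A *v v = l *\<^sub>R v" by (simp add: B)
  moreover have "v \<noteq> 0" using v by auto
  ultimately show thesis using that bound by blast
qed

text \<open>The \<open>LEAST\<close> in \<open>lambda_min\<close> is informative only once a least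
  eigenvalue is exhibited; the minimum of the Rayleigh quotient is one, since every eigenvalue is a
  value of that quotient.\<close>

lemma lambda_min_le_Rayleigh:
  fixes A :: "real^'d^'d"
  assumes "symmetric A"
  shows "lambda_min A * (norm w)\<^sup>2 \<le> w \<bullet> (A *v w)"
    and lambda_min_eigenvalue: "\<exists>v. v \<noteq> 0 \<and> A *v v = lambda_min A *\<^sub>R v"
proof -
  obtain v l where v: "v \<noteq> 0" "A *v v = l *\<^sub>R v" "\<And>w. l * (norm w)\<^sup>2 \<le> w \<bullet> (A *v w)"
    using symmetric_least_eigenvalue[OF assms] by blast
  have "lambda_min A = l"
    unfolding lambda_min_def
  proof (rule Least_equality)
    show "\<exists>v. v \<noteq> 0 \<and> A *v v = l *\<^sub>R v" using v by blast
    fix m assume "\<exists>u. u \<noteq> 0 \<and> A *v u = m *\<^sub>R u"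
    then obtain u where "u \<noteq> 0" "A *v u = m *\<^sub>R u" by blast
    with v(3)[of u] show "l \<le> m" by (simp add: power2_norm_eq_inner)
  qed
  then show "lambda_min A * (norm w)\<^sup>2 \<le> w \<bullet> (A *v w)"
    and "\<exists>v. v \<noteq> 0 \<and> A *v v = lambda_min A *\<^sub>R v" using v by auto
qed

lemma pos_def_lambda_min_pos:
  assumes "pos_def A"
  shows "0 < lambda_min A"
proof -
  obtain v where v: "v \<noteq> 0" "A *v v = lambda_min A *\<^sub>R v"
    using lambda_min_eigenvalue assms unfolding pos_def_def by blast
  have "0 < v \<bullet> (A *v v)" using assms v(1) by (simp add: pos_def_def)
  then have "0 < lambda_min A * (v \<bullet> v)" by (simp add: v(2))
  moreover have "0 < v \<bullet> v" using v(1) by simp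
  ultimately show ?thesis by (rule zero_less_mult_pos2)
qed

text \<open>Shifting \<open>A\<close> by its least eigenvalue leaves a positive semidefinite matrix,
  whose trace product with \<open>G\<close> is nonnegative.\<close>

lemma lambda_min_trace_le:
  assumes A: "symmetric A" and G: "psd G"
  shows "lambda_min A * trace G \<le> trace (A ** G)"
proof -
  define B where "B = A - lambda_min A *\<^sub>R mat 1"
  have sym: "symmetric B"
    using A unfolding symmetric_def B_def by (simp add: vec_eq_iff transpose_def mat_def)
  have "psd B"
    unfolding psd_def using sym lambda_min_le_Rayleigh(1)[OF A]
    by (simp add: B_def matrix_vector_mult_diff_rdistrib scaleR_matrix_vector_assoc[symmetric]
        inner_diff_right power2_norm_eq_inner)
  then have "0 \<le> trace (B ** G)" using G by (rule psd_trace_mult_nonneg)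
  also have "trace (B ** G) = trace (A ** G) - lambda_min A * trace (mat 1 ** G)"
    using trace_mult_eq_inner[OF sym, of G] trace_mult_eq_inner[OF A, of G]
      trace_mult_eq_inner[of "mat 1" G]
    by (simp add: B_def inner_diff_left symmetric_def transpose_mat)
  finally show ?thesis by simp
qed

text \<open>The supremum defining \<open>spectral_radius\<close> must be shown to be over a bounded
  set. Reading the eigenvalue equation at an entry of \<open>u\<close> of largest modulus bounds
  every complex eigenvalue by a row sum of absolute values, hence by \<open>S\<close>.\<close>

lemma real_eigenvalue_le_spectral_radius:
  fixes B :: "real^'d^'d"
  assumes "v \<noteq> 0" "B *v v = l *\<^sub>R v"
  shows "\<bar>l\<bar> \<le> spectral_radius B"
proof -
  let ?C = "map_matrix complex_of_real B"
  define S where "S = (\<Sum>i\<in>UNIV. \<Sum>j\<in>UNIV. \<bar>B $ i $ j\<bar>)"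
  have bound: "cmod m \<le> S" if u: "u \<noteq> 0" "?C *v u = m *s u" for m u
  proof -
    define c where "c = Max (range (\<lambda>i. cmod (u $ i)))"
    have le: "cmod (u $ j) \<le> c" for j by (simp add: c_def)
    have "c \<in> range (\<lambda>i. cmod (u $ i))" unfolding c_def by (intro Max_in) auto
    then obtain i where i: "c = cmod (u $ i)" by blast
    obtain j where "u $ j \<noteq> 0" using u by (auto simp: vec_eq_iff)
    then have c: "0 < c" using le[of j] by (metis less_le_trans zero_less_norm_iff)
    have "cmod m * c = cmod ((?C *v u) $ i)" by (simp add: u i norm_mult)
    also have "\<dots> \<le> (\<Sum>j\<in>UNIV. \<bar>B $ i $ j\<bar> * cmod (u $ j))"
      unfolding matrix_vector_mult_def
      by (auto intro!: sum_norm_le simp: map_matrix_def norm_mult)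
    also have "\<dots> \<le> (\<Sum>j\<in>UNIV. \<bar>B $ i $ j\<bar> * c)"
      by (intro sum_mono mult_left_mono le) simp
    also have "\<dots> = (\<Sum>j\<in>UNIV. \<bar>B $ i $ j\<bar>) * c" by (simp add: sum_distrib_right)
    also have "\<dots> \<le> S * c"
      unfolding S_def using c
      by (intro mult_right_mono member_le_sum[where f="\<lambda>i. \<Sum>j\<in>UNIV. \<bar>B $ i $ j\<bar>"])
         (auto intro: sum_nonneg)
    finally show ?thesis using c by simp
  qed
  define u :: "complex^'d" where "u = (\<chi> i. complex_of_real (v $ i))"
  have "u \<noteq> 0" using assms(1) by (auto simp: u_def vec_eq_iff)
  moreover have "?C *v u = complex_of_real l *s u"
  proof -
    have "(?C *v u) $ i = complex_of_real ((B *v v) $ i)" for i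
      by (simp add: matrix_vector_mult_def map_matrix_def u_def)
    then show ?thesis using assms(2) by (simp add: vec_eq_iff u_def)
  qed
  ultimately have
 "cmod (complex_of_real l) \<in> {cmod l | l. \<exists>v. v \<noteq> 0 \<and> ?C *v v = l *s v}"
    by (intro CollectI exI[of _ "complex_of_real l"] exI[of _ u] conjI refl)
  moreover have "bdd_above {cmod l | l. \<exists>v. v \<noteq> 0 \<and> ?C *v v = l *s v}"
    using bound by (auto intro!: bdd_aboveI[where M=S])
  ultimately have "cmod (complex_of_real l) \<le> spectral_radius B"
    unfolding spectral_radius_def by (rule cSup_upper)
  then show ?thesis by simp
qed

lemma uminus_matrix_vector_mult:
  fixes A :: "real^'n^'m"
  shows "(- A) *v w = - (A *v w)"
  using matrix_vector_mult_diff_rdistrib[of 0 A w] by simp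

text \<open>The least eigenvalue of \<open>- (B ** B)\<close> is minus the squared operator norm of
  \<open>B\<close>. Its square root \<open>s\<close> is, up to sign, an eigenvalue of
  \<open>B\<close>, so the spectral radius controls the operator norm.\<close>

lemma symmetric_norm_mult_le:
  fixes B :: "real^'d^'d"
  assumes sym: "symmetric B" and \<nu>: "spectral_radius B \<le> \<nu>"
  shows "norm (B *v w) \<le> \<nu> * norm w"
proof -
  have form: "w \<bullet> ((- (B ** B)) *v w) = - (norm (B *v w))\<^sup>2" for w
    using symmetric_inner_commute[OF sym, of w "B *v w"]
    by (simp add: matrix_vector_mul_assoc[symmetric] power2_norm_eq_inner
        uminus_matrix_vector_mult)
  have "symmetric (- (B ** B))"
  proof -
    have "transpose (B ** B) = B ** B"
      using sym unfolding symmetric_def by (simp only: matrix_transpose_mul)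
    then show ?thesis
      unfolding symmetric_def by (simp add: vec_eq_iff transpose_def)
  qed
  then obtain v l where v: "v \<noteq> 0" "(- (B ** B)) *v v = l *\<^sub>R v"
    and l: "\<And>w. l * (norm w)\<^sup>2 \<le> w \<bullet> ((- (B ** B)) *v w)"
    using symmetric_least_eigenvalue by blast
  have "l * (norm v)\<^sup>2 = - (norm (B *v v))\<^sup>2"
    using form[of v] v by (simp add: power2_norm_eq_inner)
  then have "l * (norm v)\<^sup>2 \<le> 0" by simp
  then have "l \<le> 0" using v(1) by (simp add: mult_le_0_iff)
  define s where "s = sqrt (- l)"
  have s: "0 \<le> s" "s\<^sup>2 = - l" using \<open>l \<le> 0\<close> by (auto simp: s_def)
  have BB: "B *v (B *v v) = s\<^sup>2 *\<^sub>R v"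
  proof -
    have "B *v (B *v v) = - ((- (B ** B)) *v v)"
      by (simp add: matrix_vector_mul_assoc uminus_matrix_vector_mult)
    then show ?thesis using v(2) s by simp
  qed
  have "s \<le> spectral_radius B"
  \<comment> \<open>Since (B - s)(B + s) annihilates \<open>v\<close>, either \<open>v\<close> is an
    eigenvector for \<open>-s\<close>, or \<open>B *v v + s *\<^sub>R v\<close> is one for
    \<open>s\<close>.\<close>
  proof (cases "B *v v + s *\<^sub>R v = 0")
    case True
    then have "B *v v = (- s) *\<^sub>R v" by (simp add: eq_neg_iff_add_eq_0)
    then show ?thesis using real_eigenvalue_le_spectral_radius[OF v(1), of B "- s"] s by simp
  next
    case False
    moreover have "B *v (B *v v + s *\<^sub>R v) = s *\<^sub>R (B *v v + s *\<^sub>R v)"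
      by (simp add: matrix_vector_right_distrib matrix_vector_mult_scaleR BB
          scaleR_add_right power2_eq_square)
    ultimately show ?thesis using real_eigenvalue_le_spectral_radius s by fastforce
  qed
  then have "s * norm w \<le> \<nu> * norm w" using \<nu> by (intro mult_right_mono) auto
  moreover have "norm (B *v w) \<le> s * norm w"
  proof (rule power2_le_imp_le)
    show "(norm (B *v w))\<^sup>2 \<le> (s * norm w)\<^sup>2"
      using l[of w] form[of w] s by (simp add: power_mult_distrib)
  qed (use s in simp)
  ultimately show ?thesis by simp
qed

section \<open>Averaging and powers of the consensus matrix\<close>

lemma one_inner_one: "(1 :: real^'v) \<bullet> 1 = real CARD('v)"
  by (simp add: inner_vec_def)

text \<open>\<open>avg_matrix\<close> acts as the orthogonal projection onto the line of constant
  vectors.\<close>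

lemma avg_matrix_mult: "avg_matrix *v w = ((1 \<bullet> w) / real CARD('v)) *\<^sub>R (1 :: real^'v)"
  by (simp add: vec_eq_iff matrix_vector_mult_def avg_matrix_def inner_vec_def sum_divide_distrib)

lemma avg_matrix_mult_inner: "(w - avg_matrix *v w) \<bullet> (1 :: real^'v) = 0"
  by (simp add: avg_matrix_mult inner_diff_left one_inner_one inner_commute[of w])

lemma norm_avg_matrix_Pythagoras:
  fixes w :: "real^'v"
  shows "(norm w)\<^sup>2 = (norm (w - avg_matrix *v w))\<^sup>2 + (norm (avg_matrix *v w))\<^sup>2"
proof -
  have "(w - avg_matrix *v w) \<bullet> (avg_matrix *v w) = 0"
    by (subst (2) avg_matrix_mult) (simp add: avg_matrix_mult_inner)
  then have "(norm ((w - avg_matrix *v w) + avg_matrix *v w))\<^sup>2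
      = (norm (w - avg_matrix *v w))\<^sup>2 + (norm (avg_matrix *v w))\<^sup>2"
    by (rule norm_add_Pythagorean[unfolded orthogonal_def])
  then show ?thesis by simp
qed

lemma norm_diff_avg_matrix_le: "norm (w - avg_matrix *v w) \<le> norm w"
  by (rule power2_le_imp_le) (use norm_avg_matrix_Pythagoras[of w] in simp_all)

lemma matpow_mult_one: "W *v 1 = 1 \<Longrightarrow> matpow W k *v 1 = 1"
  by (induction k) (simp_all add: matrix_vector_mul_assoc[symmetric])

lemma matpow_norm_le:
  assumes "\<And>w. norm (W *v w) \<le> norm w"
  shows "norm (matpow W k *v w) \<le> norm w"
  using assms
  by (induction k) (auto simp: matrix_vector_mul_assoc[symmetric] intro: order_trans)

context
  fixes E :: "'v::finite \<Rightarrow> 'v \<Rightarrow> bool" and \<nu> :: real and W :: "real^'v^'v"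
  assumes W: "consensus_matrix E \<nu> W" and \<nu>: "0 \<le> \<nu>"
begin

text \<open>\<open>W\<close> fixes the all-ones vector, so \<open>W - avg_matrix\<close> annihilates
  it; by symmetry the range of this difference is orthogonal to it.\<close>

lemma consensus_matrix_diff_avg:
  shows "symmetric (W - avg_matrix)"
    and "norm ((W - avg_matrix) *v w) \<le> \<nu> * norm w"
    and "(W - avg_matrix) *v (avg_matrix *v w) = 0"
    and "1 \<bullet> ((W - avg_matrix) *v w) = 0"
proof -
  have symW: "transpose W = W" and W1: "W *v 1 = 1"
    and rad: "spectral_radius (W - avg_matrix) \<le> \<nu>"
    using W by (auto simp: consensus_matrix_def)
  have "W $ j $ i = W $ i $ j" for i j
    by (rule symmetric_component) (simp only: symmetric_def symW)
  then show sym: "symmetric (W - avg_matrix)"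
    by (simp add: symmetric_def vec_eq_iff transpose_def avg_matrix_def)
  show "norm ((W - avg_matrix) *v w) \<le> \<nu> * norm w"
    by (rule symmetric_norm_mult_le[OF sym rad])
  have one: "(W - avg_matrix) *v 1 = 0"
    by (simp add: matrix_vector_mult_diff_rdistrib W1 avg_matrix_mult one_inner_one)
  then show "(W - avg_matrix) *v (avg_matrix *v w) = 0"
    by (simp add: avg_matrix_mult[of w] matrix_vector_mult_scaleR)
  show "1 \<bullet> ((W - avg_matrix) *v w) = 0"
    using symmetric_inner_commute[OF sym, of 1 w] by (simp add: one)
qed

text \<open>Split a vector into its mean and its deviation: \<open>W\<close> keeps the former,
  contracts the latter, and the two images stay orthogonal.\<close>

lemma consensus_matrix_norm_le:
  assumes "\<nu> \<le> 1"
  shows "norm (W *v w) \<le> norm w"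
proof (rule power2_le_imp_le)
  let ?B = "W - avg_matrix" and ?u = "w - avg_matrix *v w"
  have "norm (?B *v w) = norm (?B *v ?u)"
    by (simp add: matrix_vector_mult_diff_distrib consensus_matrix_diff_avg(3))
  also have "\<dots> \<le> \<nu> * norm ?u" by (rule consensus_matrix_diff_avg(2))
  also have "\<dots> \<le> norm ?u" using assms by (simp add: mult_left_le_one_le \<nu>)
  finally have "(norm (?B *v w))\<^sup>2 \<le> (norm ?u)\<^sup>2" by simp
  moreover have "(norm (?B *v w + avg_matrix *v w))\<^sup>2
      = (norm (?B *v w))\<^sup>2 + (norm (avg_matrix *v w))\<^sup>2"
    by (rule norm_add_Pythagorean)
       (use consensus_matrix_diff_avg(4) in
        \<open>simp add: orthogonal_def avg_matrix_mult[of w] inner_commute[of _ 1]\<close>)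
  ultimately show "(norm (W *v w))\<^sup>2 \<le> (norm w)\<^sup>2"
    using norm_avg_matrix_Pythagoras[of w] by (simp add: matrix_vector_mult_diff_rdistrib)
qed simp

lemma matpow_diff_avg_norm_le: "norm ((matpow W k - avg_matrix) *v w) \<le> \<nu> ^ k * norm w"
proof (induction k)
  case 0
  show ?case
    using norm_diff_avg_matrix_le[of w] by (simp add: matrix_vector_mult_diff_rdistrib)
next
  case (Suc k)
  \<comment> \<open>Powers of \<open>W\<close> preserve the mean. Hence the cross terms cancel, and
    the deviation of \<open>matpow W (Suc k)\<close> from averaging is one more factor
    \<open>W - avg_matrix\<close> applied to that of \<open>matpow W k\<close>.\<close>
  have "avg_matrix *v (matpow W k *v w) = avg_matrix *v w"
  proof (induction k)
    case (Suc k)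
    have "1 \<bullet> (W *v u) = 1 \<bullet> u" for u
      using consensus_matrix_diff_avg(4)[of u]
      by (simp add: matrix_vector_mult_diff_rdistrib avg_matrix_mult inner_diff_right one_inner_one)
    then show ?case using Suc by (simp add: matrix_vector_mul_assoc[symmetric] avg_matrix_mult)
  qed simp
  then have "(matpow W (Suc k) - avg_matrix) *v w
      = (W - avg_matrix) *v ((matpow W k - avg_matrix) *v w)"
    using consensus_matrix_diff_avg(3)[of w]
    by (simp add: matrix_vector_mult_diff_rdistrib matrix_vector_mult_diff_distrib
        matrix_vector_mul_assoc[symmetric])
  then have "norm ((matpow W (Suc k) - avg_matrix) *v w)
      \<le> \<nu> * norm ((matpow W k - avg_matrix) *v w)"
    using consensus_matrix_diff_avg(2) by simp
  also have "\<dots> \<le> \<nu> * (\<nu> ^ k * norm w)" by (intro mult_left_mono Suc \<nu>)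
  finally show ?case by simp
qed

lemma matpow_component_diff_avg_le: "\<bar>(matpow W k - avg_matrix) $ i $ j\<bar> \<le> \<nu> ^ k"
proof -
  let ?C = "matpow W k - avg_matrix"
  have "\<bar>?C $ i $ j\<bar> = \<bar>(?C *v axis j 1) $ i\<bar>"
    by (simp add: matrix_vector_mult_basis column_def)
  also have "\<dots> \<le> norm (?C *v axis j 1)" by (rule component_le_norm_cart)
  also have "\<dots> \<le> \<nu> ^ k * norm (axis j 1 :: real^'v)" by (rule matpow_diff_avg_norm_le)
  finally show ?thesis by simp
qed

end

section \<open>A distributed projected supergradient method over a closed convex set\<close>

text \<open>The squared distance in a product is a sum, so it is minimised factor by factor. This
  turns the separate projections of multiplier and matrix into one projection of the stacked
  variable.\<close>

lemma closest_point_Times: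
  fixes S :: "'a::euclidean_space set" and T :: "'b::euclidean_space set"
  assumes "convex S" "closed S" "S \<noteq> {}" "convex T" "closed T" "T \<noteq> {}"
  shows "closest_point (S \<times> T) (a, b) = (closest_point S a, closest_point T b)"
  by (rule closest_point_unique[symmetric])
     (use assms in \<open>auto simp: convex_Times closed_Times closest_point_in_set dist_Pair_Pair
        intro!: add_mono power_mono closest_point_le\<close>)

text \<open>In an orthonormal basis the mixing acts on each coordinate separately, so the bound for
  scalar entries carries over to vectors.\<close>

lemma sum_norm_square_mix_le:
  fixes P :: "real^'v^'v" and u :: "'v \<Rightarrow> 'a::euclidean_space"
  assumes P: "\<And>w. norm (P *v w) \<le> norm w"
  shows "(\<Sum>i\<in>UNIV. (norm (\<Sum>j\<in>UNIV. P $ i $ j *\<^sub>R u j))\<^sup>2) \<le> (\<Sum>j\<in>UNIV. (norm (u j))\<^sup>2)"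
proof -
  define w where "w b = (\<chi> j. u j \<bullet> b)" for b
  have norm_sq: "(norm x)\<^sup>2 = (\<Sum>b\<in>Basis. (x \<bullet> b)\<^sup>2)" for x :: 'a
    by (subst power2_norm_eq_inner, subst euclidean_inner) (simp add: power2_eq_square)
  have norm_vec_sq: "(norm x)\<^sup>2 = (\<Sum>i\<in>UNIV. (x $ i)\<^sup>2)" for x :: "real^'v"
    unfolding power2_norm_eq_inner by (simp add: inner_vec_def power2_eq_square)
  have "(\<Sum>i\<in>UNIV. (norm (\<Sum>j\<in>UNIV. P $ i $ j *\<^sub>R u j))\<^sup>2)
      = (\<Sum>i\<in>UNIV. \<Sum>b\<in>Basis. ((P *v w b) $ i)\<^sup>2)"
    by (simp add: norm_sq inner_sum_left matrix_vector_mult_def w_def)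
  also have "\<dots> = (\<Sum>b\<in>Basis. (norm (P *v w b))\<^sup>2)"
    unfolding norm_vec_sq by (rule sum.swap)
  also have "\<dots> \<le> (\<Sum>b\<in>Basis. (norm (w b))\<^sup>2)"
    by (intro sum_mono power_mono P) simp
  also have "\<dots> = (\<Sum>j\<in>UNIV. \<Sum>b\<in>Basis. (u j \<bullet> b)\<^sup>2)"
    unfolding norm_vec_sq by (subst sum.swap) (simp add: w_def)
  also have "\<dots> = (\<Sum>j\<in>UNIV. (norm (u j))\<^sup>2)" by (simp add: norm_sq)
  finally show ?thesis .
qed

text \<open>By contradiction: were the target missed at node \<open>i\<close> from \<open>N\<close>
  on, the nonnegative Lyapunov function would eventually fall by a fixed amount at every step.
  \<open>C\<close> exceeds the cost of the squared step plus that of the limiting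
  disagreement.\<close>

lemma distributed_projected_supergradient:
  fixes z s :: "nat \<Rightarrow> 'v::finite \<Rightarrow> 'a::euclidean_space" and P :: "real^'v^'v"
    and q :: "'v \<Rightarrow> 'a \<Rightarrow> real" and n p \<alpha> b\<^sub>0 M C :: real
  defines "n \<equiv> real CARD('v)"
  assumes D: "convex D" "closed D"
    and P1: "P *v 1 = 1"
    and Pnorm: "\<And>w. norm (P *v w) \<le> norm w"
    and Pavg: "\<And>i j. n * \<bar>P $ i $ j - 1 / n\<bar> \<le> p"
    and p: "0 \<le> p" "p < 1"
    and \<alpha>: "0 < \<alpha>"
    and step: "\<And>k i. z (Suc k) i
        = closest_point D (\<Sum>j\<in>UNIV. P $ i $ j *\<^sub>R (z k j + \<alpha> *\<^sub>R s k j))"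
    and sM: "\<And>k j. norm (s k j) \<le> M"
    and super: "\<And>k j y. y \<in> D \<Longrightarrow> q j y \<le> q j (z k j) + s k j \<bullet> (y - z k j)"
    and lip: "\<And>j y y'. y \<in> D \<Longrightarrow> y' \<in> D \<Longrightarrow> q j y \<le> q j y' + M * norm (y - y')"
    and init: "\<And>i. norm (\<Sum>j\<in>UNIV. (P $ i $ j - 1 / n) *\<^sub>R (z 0 j + \<alpha> *\<^sub>R s 0 j)) \<le> b\<^sub>0"
    and zs: "zs \<in> D"
    and C: "\<alpha> * n * M\<^sup>2 / 2 + 2 * n * M * (p * \<alpha> * M / (1 - p)) < C"
  shows "\<exists>k\<ge>N. (\<Sum>j\<in>UNIV. q j zs) - C < (\<Sum>j\<in>UNIV. q j (z k i))"
proof (rule ccontr)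
  assume "\<not> ?thesis"
  then have low: "(\<Sum>j\<in>UNIV. q j (z k i)) \<le> (\<Sum>j\<in>UNIV. q j zs) - C" if "N \<le> k" for k
    using that not_le by blast
  have n: "0 < n" by (simp add: n_def)
  have M: "0 \<le> M" using sM norm_ge_zero order_trans by blast
  have D0: "D \<noteq> {}" using zs by auto
  have row: "(\<Sum>j\<in>UNIV. P $ i $ j) = 1" for i
    using arg_cong[OF P1, of "\<lambda>x. x $ i"] by (simp add: matrix_vector_mult_def)
  define u where "u k j = z k j + \<alpha> *\<^sub>R s k j" for k j
  define v where "v k i = (\<Sum>j\<in>UNIV. P $ i $ j *\<^sub>R u k j)" for k i
  define vb where "vb k = (\<Sum>j\<in>UNIV. (1 / n) *\<^sub>R u k j)" for k
  have z_Suc: "z (Suc k) i = closest_point D (v k i)" for k i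
    by (simp add: step v_def u_def)
  \<comment> \<open>The initial points may lie outside \<open>D\<close>; therefore all estimates
    using \<open>lip\<close> start at index \<open>Suc k\<close>.\<close>
  have z_in: "z (Suc k) i \<in> D" for k i
    unfolding z_Suc by (rule closest_point_in_set[OF D(2) D0])
  \<comment> \<open>The rows of \<open>P\<close> sum to one, so the weights sum to zero and any
    reference point \<open>y\<close> may be subtracted for free.\<close>
  have v_diff: "v k i - vb k = (\<Sum>j\<in>UNIV. (P $ i $ j - 1 / n) *\<^sub>R (u k j - y))" for k i y
  proof -
    have "(\<Sum>j\<in>UNIV. (P $ i $ j - 1 / n) *\<^sub>R y) = 0"
      by (simp add: scaleR_sum_left[symmetric] sum_subtractf row n_def)
    then show ?thesis
      by (simp add: v_def vb_def scaleR_diff_left scaleR_diff_right sum_subtractf)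
  qed
  \<comment> \<open>The explicit solution of the recursion \<open>b_Suc\<close> with initial value
    \<open>b\<^sub>0\<close>: its fixed point plus a geometrically decaying term.\<close>
  define b where "b k = p * \<alpha> * M / (1 - p) + p ^ k * (b\<^sub>0 - p * \<alpha> * M / (1 - p))" for k
  have b_Suc: "b (Suc k) = p * (b k + \<alpha> * M)" for k
  proof -
    have "p * \<alpha> * M / (1 - p) = p * (p * \<alpha> * M / (1 - p)) + p * \<alpha> * M"
      using p by (simp add: field_simps)
    then show ?thesis by (simp only: b_def distrib_left power_Suc mult.assoc)
  qed
  have v_bound: "norm (v k i - vb k) \<le> b k" for k i
  proof (induction k arbitrary: i)
    case 0
    show ?case using init[of i] v_diff[of 0 i 0] by (simp add: b_def u_def)
  next
    case (Suc k)
    \<comment> \<open>With the projected mean as reference, nonexpansiveness of the projection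
      reduces the distance to that of \<open>v\<close> from \<open>vb\<close>, which the induction
      hypothesis bounds.\<close>
    define y where "y = closest_point D (vb k)"
    have u: "norm (u (Suc k) j - y) \<le> b k + \<alpha> * M" for j
    proof -
      have "norm (z (Suc k) j - y) \<le> norm (v k j - vb k)"
        unfolding z_Suc y_def dist_norm[symmetric]
        by (rule closest_point_lipschitz[OF D D0])
      also have "\<dots> \<le> b k" by (rule Suc)
      finally have "norm (z (Suc k) j - y) \<le> b k" .
      moreover have "norm (\<alpha> *\<^sub>R s (Suc k) j) \<le> \<alpha> * M" using sM \<alpha> by simp
      ultimately have "norm ((z (Suc k) j - y) + \<alpha> *\<^sub>R s (Suc k) j) \<le> b k + \<alpha> * M"
        by (rule norm_triangle_mono)
      then show ?thesis by (simp add: u_def algebra_simps)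
    qed
    have "norm (v (Suc k) i - vb (Suc k)) \<le> (\<Sum>j\<in>(UNIV::'v set). p / n * (b k + \<alpha> * M))"
      unfolding v_diff[of _ _ y]
    proof (rule sum_norm_le)
      fix j
      have "\<bar>P $ i $ j - 1 / n\<bar> \<le> p / n" using Pavg[of i j] n by (simp add: field_simps)
      then show "norm ((P $ i $ j - 1 / n) *\<^sub>R (u (Suc k) j - y)) \<le> p / n * (b k + \<alpha> * M)"
        unfolding norm_scaleR by (intro mult_mono u) (use p n in auto)
    qed
    also have "\<dots> = b (Suc k)" using n by (simp add: b_Suc n_def)
    finally show ?case .
  qed
  have z_diff: "norm (z (Suc k) i - z (Suc k) j) \<le> 2 * b k" for k i j
  proof -
    have "norm (z (Suc k) i - z (Suc k) j) \<le> norm (v k i - v k j)"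
      unfolding z_Suc dist_norm[symmetric] by (rule closest_point_lipschitz[OF D D0])
    also have "\<dots> \<le> norm (v k i - vb k) + norm (v k j - vb k)"
      using norm_triangle_ineq4[of "v k i - vb k" "v k j - vb k"] by simp
    also have "\<dots> \<le> b k + b k" by (intro add_mono v_bound)
    finally show ?thesis by simp
  qed
  define V where "V k = (\<Sum>i\<in>UNIV. (norm (z k i - zs))\<^sup>2)" for k
  have V_le: "V (Suc (Suc k)) \<le> V (Suc k)
      + 2 * \<alpha> * ((\<Sum>j\<in>UNIV. q j (z (Suc k) i)) - (\<Sum>j\<in>UNIV. q j zs) + 2 * n * M * b k)
      + n * \<alpha>\<^sup>2 * M\<^sup>2" for k
  proof -
    let ?z = "z (Suc k)" and ?s = "s (Suc k)"
    have "V (Suc (Suc k)) \<le> (\<Sum>i\<in>UNIV. (norm (\<Sum>j\<in>UNIV. P $ i $ j *\<^sub>R (u (Suc k) j - zs)))\<^sup>2)"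
      unfolding V_def
    proof (intro sum_mono power_mono norm_ge_zero)
      fix i
      \<comment> \<open>\<open>zs\<close> is its own projection, and since the rows sum to one it
        can be moved inside the weighted sum.\<close>
      have "norm (z (Suc (Suc k)) i - zs) \<le> norm (v (Suc k) i - zs)"
        using closest_point_lipschitz[OF D D0, of "v (Suc k) i" zs] zs
        by (simp add: z_Suc[of "Suc k"] dist_norm closest_point_self)
      also have "v (Suc k) i - zs = (\<Sum>j\<in>UNIV. P $ i $ j *\<^sub>R (u (Suc k) j - zs))"
        by (simp add: v_def scaleR_diff_right sum_subtractf scaleR_sum_left[symmetric] row)
      finally show "norm (z (Suc (Suc k)) i - zs)
        \<le> norm (\<Sum>j\<in>UNIV. P $ i $ j *\<^sub>R (u (Suc k) j - zs))" .
    qed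
    also have "\<dots> \<le> (\<Sum>j\<in>UNIV. (norm (u (Suc k) j - zs))\<^sup>2)"
      by (rule sum_norm_square_mix_le[OF Pnorm])
    also have "\<dots> \<le> (\<Sum>j\<in>UNIV. (norm (?z j - zs))\<^sup>2
        + 2 * \<alpha> * (q j (?z i) - q j zs + 2 * M * b k) + \<alpha>\<^sup>2 * M\<^sup>2)"
    proof (rule sum_mono)
      fix j
      have "(norm (u (Suc k) j - zs))\<^sup>2
          = (norm (?z j - zs))\<^sup>2 + 2 * \<alpha> * (?s j \<bullet> (?z j - zs)) + \<alpha>\<^sup>2 * (norm (?s j))\<^sup>2"
        unfolding u_def power2_norm_eq_inner
        by (simp add: inner_simps inner_commute algebra_simps power2_eq_square)
      moreover have "?s j \<bullet> (?z j - zs) \<le> q j (?z j) - q j zs"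
        using super[OF zs, of j "Suc k"] by (simp add: inner_diff_right)
      \<comment> \<open>The supergradient inequality speaks of node j's own point, the conclusion of
        node i's; the disagreement bound pays for the exchange.\<close>
      moreover have "q j (?z j) \<le> q j (?z i) + M * (2 * b k)"
      proof -
        have "q j (?z j) \<le> q j (?z i) + M * norm (?z j - ?z i)" by (intro lip z_in)
        also have "\<dots> \<le> q j (?z i) + M * (2 * b k)"
          by (intro add_left_mono mult_left_mono z_diff M)
        finally show ?thesis .
      qed
      ultimately have "?s j \<bullet> (?z j - zs) \<le> q j (?z i) - q j zs + 2 * M * b k" by linarith
      then have "2 * \<alpha> * (?s j \<bullet> (?z j - zs)) \<le> 2 * \<alpha> * (q j (?z i) - q j zs + 2 * M * b k)"
        using \<alpha> by simp
      moreover have "\<alpha>\<^sup>2 * (norm (?s j))\<^sup>2 \<le> \<alpha>\<^sup>2 * M\<^sup>2"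
        by (intro mult_left_mono power_mono sM) auto
      ultimately show "(norm (u (Suc k) j - zs))\<^sup>2 \<le> (norm (?z j - zs))\<^sup>2
          + 2 * \<alpha> * (q j (?z i) - q j zs + 2 * M * b k) + \<alpha>\<^sup>2 * M\<^sup>2"
        using \<open>(norm (u (Suc k) j - zs))\<^sup>2 = _\<close> by linarith
    qed
    also have "\<dots> = V (Suc k)
      + 2 * \<alpha> * ((\<Sum>j\<in>UNIV. q j (?z i)) - (\<Sum>j\<in>UNIV. q j zs) + 2 * n * M * b k)
      + n * \<alpha>\<^sup>2 * M\<^sup>2"
      by (simp add: V_def sum.distrib sum_subtractf sum_distrib_left[symmetric] n_def algebra_simps)
    finally show ?thesis .
  qed
  \<comment> \<open>The slack in \<open>C\<close>. Half of it absorbs the excess of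
    \<open>b k\<close> over its limit; the other half is the gain per step, which the factor
    \<open>2 * \<alpha>\<close> turns into \<open>\<alpha> * e\<close>.\<close>
  define e where "e = C - (\<alpha> * n * M\<^sup>2 / 2 + 2 * n * M * (p * \<alpha> * M / (1 - p)))"
  have e: "0 < e" using C by (simp add: e_def)
  have "(\<lambda>k. p ^ k) \<longlonglongrightarrow> 0" using p by (rule LIMSEQ_realpow_zero)
  then have "(\<lambda>k. 2 * n * M * b k) \<longlonglongrightarrow>
      2 * n * M * (p * \<alpha> * M / (1 - p) + 0 * (b\<^sub>0 - p * \<alpha> * M / (1 - p)))"
    unfolding b_def by (intro tendsto_mult tendsto_add tendsto_const)
  moreover have "2 * n * M * (p * \<alpha> * M / (1 - p) + 0 * (b\<^sub>0 - p * \<alpha> * M / (1 - p)))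
      < 2 * n * M * (p * \<alpha> * M / (1 - p)) + e / 2" using e by simp
  ultimately have "\<forall>\<^sub>F k in sequentially. 2 * n * M * b k < 2 * n * M * (p * \<alpha> * M / (1 - p)) + e / 2"
    by (rule order_tendstoD(2))
  then obtain K where K: "\<And>k. K \<le> k \<Longrightarrow> 2 * n * M * b k < 2 * n * M * (p * \<alpha> * M / (1 - p)) + e / 2"
    by (auto simp: eventually_sequentially)
  have V_dec: "V (Suc (Suc k)) \<le> V (Suc k) - \<alpha> * e" if "max N K \<le> k" for k
  proof -
    have "(\<Sum>j\<in>UNIV. q j (z (Suc k) i)) - (\<Sum>j\<in>UNIV. q j zs) + 2 * n * M * b k
        \<le> - C + (2 * n * M * (p * \<alpha> * M / (1 - p)) + e / 2)"
      using low[of "Suc k"] K[of k] that by simp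
    then have "2 * \<alpha> * ((\<Sum>j\<in>UNIV. q j (z (Suc k) i)) - (\<Sum>j\<in>UNIV. q j zs) + 2 * n * M * b k)
        \<le> 2 * \<alpha> * (- C + (2 * n * M * (p * \<alpha> * M / (1 - p)) + e / 2))"
      using \<alpha> by simp
    also have "- C + (2 * n * M * (p * \<alpha> * M / (1 - p)) + e / 2) = - e / 2 - \<alpha> * n * M\<^sup>2 / 2"
      using e_def by linarith
    also have "2 * \<alpha> * (- e / 2 - \<alpha> * n * M\<^sup>2 / 2) = - \<alpha> * e - n * \<alpha>\<^sup>2 * M\<^sup>2"
      by (simp add: algebra_simps power2_eq_square)
    finally show ?thesis using V_le[of k] by simp
  qed
  define K' where "K' = Suc (max N K)"
  have "V (K' + m) \<le> V K' - real m * (\<alpha> * e)" for m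
  proof (induction m)
    case (Suc m)
    then show ?case using V_dec[of "max N K + m"] by (simp add: K'_def algebra_simps)
  qed simp
  moreover have "0 \<le> V (K' + m)" for m by (simp add: V_def sum_nonneg)
  ultimately have "0 \<le> V K' - real m * (\<alpha> * e)" for m using order_trans by blast
  moreover obtain m where "V K' < real m * (\<alpha> * e)"
    using reals_Archimedean3[of "\<alpha> * e"] \<alpha> e by auto
  ultimately show False by (metis diff_ge_0_iff_ge not_le)
qed

section \<open>The positive semidefinite cone and the dual function\<close>

lemma symmetric_add: "symmetric A \<Longrightarrow> symmetric B \<Longrightarrow> symmetric (A + B)"
  and symmetric_scaleR: "symmetric A \<Longrightarrow> symmetric (c *\<^sub>R A)"
  by (simp_all add: symmetric_def vec_eq_iff transpose_def)

lemma closed_psd: "closed {H :: real^'d^'d. psd H}"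
proof -
  have "{H :: real^'d^'d. psd H}
      = (\<Inter>i. \<Inter>j. {H. H $ i $ j = H $ j $ i}) \<inter> (\<Inter>v. {H. 0 \<le> v \<bullet> (H *v v)})"
    by (auto simp: psd_def symmetric_def transpose_def vec_eq_iff)
  moreover have "closed {H :: real^'d^'d. H $ i $ j = H $ j $ i}" for i j
    by (intro closed_Collect_eq continuous_intros)
  moreover have "closed {H :: real^'d^'d. 0 \<le> v \<bullet> (H *v v)}" for v
    unfolding matrix_vector_mult_def inner_vec_def
    by (intro closed_Collect_le) (auto intro!: continuous_intros)
  ultimately show ?thesis by (simp add: closed_INT closed_Int)
qed

lemma convex_psd: "convex {H :: real^'d^'d. psd H}"
proof (rule convexI)
  fix G H :: "real^'d^'d" and a b :: real
  assume "G \<in> {H. psd H}" "H \<in> {H. psd H}" "0 \<le> a" "0 \<le> b"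
  then show "a *\<^sub>R G + b *\<^sub>R H \<in> {H. psd H}"
    by (auto simp: psd_def symmetric_add symmetric_scaleR matrix_vector_mult_add_rdistrib
        scaleR_matrix_vector_assoc[symmetric] inner_add_right)
qed

context
  fixes f g :: "'v::finite \<Rightarrow> real \<Rightarrow> real" and X :: "'v \<Rightarrow> real set"
    and A0 :: "real^'d^'d" and A :: "'v \<Rightarrow> real^'d^'d"
  assumes f: "\<And>i. convex_on UNIV (f i)" and g: "\<And>i. convex_on UNIV (g i)"
    and X: "\<And>i. compact (X i)" and X0: "\<And>i. X i \<noteq> {}"
    and A0: "symmetric A0" and A: "\<And>i. symmetric (A i)"
begin

lemma symmetric_local_lmi: "symmetric (local_lmi A0 A i x)"
  unfolding local_lmi_def by (intro symmetric_add symmetric_scaleR A0 A)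

text \<open>For fixed \<open>x\<close> the Lagrangian is affine in the stacked dual variable. Its
  slope, the pair of constraint values, supplies both the supergradient and the Lipschitz
  constant.\<close>

lemma lagrangian_affine:
  "lagrangian f g A0 A i x m H = f i x + (g i x, - local_lmi A0 A i x) \<bullet> (m, H)"
  by (simp add: lagrangian_def trace_mult_eq_inner[OF symmetric_local_lmi] inner_prod_def mult.commute)

lemma continuous_on_data:
  "continuous_on S (f i)" "continuous_on S (g i)" "continuous_on S (local_lmi A0 A i)"
proof -
  show "continuous_on S (f i)" "continuous_on S (g i)"
    using convex_on_continuous[OF open_UNIV f] convex_on_continuous[OF open_UNIV g]
    by (auto intro: continuous_on_subset)
  show "continuous_on S (local_lmi A0 A i)"
    unfolding local_lmi_def by (intro continuous_intros)
qed

lemma abs_g_le_bound_L: "x \<in> X i \<Longrightarrow> \<bar>g i x\<bar> \<le> bound_L g X"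
proof -
  assume x: "x \<in> X i"
  have "compact ((\<lambda>x. \<bar>g i x\<bar>) ` X i)"
    by (intro compact_continuous_image continuous_intros continuous_on_data X)
  then have "\<bar>g i x\<bar> \<le> (SUP x\<in>X i. \<bar>g i x\<bar>)"
    using x by (intro cSUP_upper bounded_imp_bdd_above compact_imp_bounded)
  also have "\<dots> \<le> bound_L g X" unfolding bound_L_def by (intro Max_ge) auto
  finally show ?thesis .
qed

lemma norm_local_lmi_le_bound_Q: "x \<in> X i \<Longrightarrow> norm (local_lmi A0 A i x) \<le> bound_Q A0 A X"
proof -
  assume x: "x \<in> X i"
  have "compact ((\<lambda>x. norm (- local_lmi A0 A i x)) ` X i)"
    by (intro compact_continuous_image continuous_intros continuous_on_data X)
  then have "norm (- local_lmi A0 A i x) \<le> (SUP x\<in>X i. norm (- local_lmi A0 A i x))"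
    using x by (intro cSUP_upper bounded_imp_bdd_above compact_imp_bounded)
  also have "\<dots> \<le> bound_Q A0 A X" unfolding bound_Q_def by (intro Max_ge) auto
  finally show ?thesis by simp
qed

lemma norm_supergradient_le:
  assumes "x \<in> X i"
  shows "norm (g i x, - local_lmi A0 A i x) \<le> bound_L g X + bound_Q A0 A X"
proof -
  have "norm (g i x, - local_lmi A0 A i x) \<le> norm (g i x) + norm (- local_lmi A0 A i x)"
    by (rule norm_Pair_le)
  also have "\<dots> \<le> bound_L g X + bound_Q A0 A X"
    using abs_g_le_bound_L[OF assms] norm_local_lmi_le_bound_Q[OF assms] by simp
  finally show ?thesis .
qed

text \<open>A real infimum is a lower bound only for a set bounded below; compactness of
  \<open>X i\<close> and continuity provide this.\<close>

lemma local_dual_le_lagrangian: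
  assumes "x \<in> X i"
  shows "local_dual f g X A0 A i m H \<le> lagrangian f g A0 A i x m H"
proof -
  have "compact ((\<lambda>x. lagrangian f g A0 A i x m H) ` X i)"
    unfolding lagrangian_affine
    by (intro compact_continuous_image continuous_intros continuous_on_data X)
  then show ?thesis
    unfolding local_dual_def
    using assms by (intro cINF_lower bounded_imp_bdd_below compact_imp_bounded)
qed

lemma local_dual_arg_min:
  assumes "is_arg_min (\<lambda>x. lagrangian f g A0 A i x m H) (\<lambda>x. x \<in> X i) x"
  shows "local_dual f g X A0 A i m H = lagrangian f g A0 A i x m H"
proof (rule antisym)
  show "local_dual f g X A0 A i m H \<le> lagrangian f g A0 A i x m H"
    using assms by (intro local_dual_le_lagrangian) (simp add: is_arg_min_def)
  show "lagrangian f g A0 A i x m H \<le> local_dual f g X A0 A i m H"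
    unfolding local_dual_def using assms
    by (intro cINF_greatest X0) (simp add: is_arg_min_linorder)
qed

text \<open>The minimiser at \<open>(m, H)\<close> is a competitor at \<open>(m', H')\<close>, and
  its Lagrangian is affine in between.\<close>

lemma local_dual_supergradient:
  assumes x: "is_arg_min (\<lambda>x. lagrangian f g A0 A i x m H) (\<lambda>x. x \<in> X i) x"
  shows "local_dual f g X A0 A i m' H' \<le> local_dual f g X A0 A i m H
    + (g i x, - local_lmi A0 A i x) \<bullet> ((m', H') - (m, H))"
proof -
  have "x \<in> X i" using x by (simp add: is_arg_min_def)
  from local_dual_le_lagrangian[OF this, of m' H'] show ?thesis
    unfolding local_dual_arg_min[OF x] lagrangian_affine inner_diff_right by simp
qed

text \<open>An infimum of affine functions whose slopes have norm at most
  \<open>bound_L g X + bound_Q A0 A X\<close> inherits that Lipschitz constant.\<close>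

lemma local_dual_Lipschitz:
  "local_dual f g X A0 A i m H
    \<le> local_dual f g X A0 A i m' H' + (bound_L g X + bound_Q A0 A X) * norm ((m, H) - (m', H'))"
proof -
  have "local_dual f g X A0 A i m H
      - (bound_L g X + bound_Q A0 A X) * norm ((m, H) - (m', H')) \<le> lagrangian f g A0 A i x m' H'"
    if x: "x \<in> X i" for x
  proof -
    let ?s = "(g i x, - local_lmi A0 A i x)"
    have "local_dual f g X A0 A i m H \<le> lagrangian f g A0 A i x m H"
      by (rule local_dual_le_lagrangian[OF x])
    also have "\<dots> = lagrangian f g A0 A i x m' H' + ?s \<bullet> ((m, H) - (m', H'))"
      unfolding lagrangian_affine inner_diff_right by simp
    also have "?s \<bullet> ((m, H) - (m', H')) \<le> norm ?s * norm ((m, H) - (m', H'))"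
      by (rule norm_cauchy_schwarz)
    also have "\<dots> \<le> (bound_L g X + bound_Q A0 A X) * norm ((m, H) - (m', H'))"
      by (intro mult_right_mono norm_supergradient_le x norm_ge_zero)
    finally show ?thesis by simp
  qed
  then have "local_dual f g X A0 A i m H
      - (bound_L g X + bound_Q A0 A X) * norm ((m, H) - (m', H')) \<le> local_dual f g X A0 A i m' H'"
    unfolding local_dual_def[of _ _ _ _ _ _ m'] by (intro cINF_greatest X0)
  then show ?thesis by simp
qed

text \<open>Insert the Slater vector into every local minimum. Its strict feasibility makes the dual
  value fall at least linearly, at rate \<open>\<gamma>\<close>, in \<open>m + trace H\<close>; the
  objective at \<open>xbar\<close> remains as the constant.\<close>

lemma dual_Slater_bound:
  assumes slater: "slater_vector g X A0 A xbar" and m: "0 \<le> m" and H: "psd H"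
    and \<gamma>: "\<gamma> \<le> - (\<Sum>i\<in>UNIV. g i (xbar i))" "\<gamma> \<le> lambda_min (lmi A0 A xbar)"
  shows "dual f g X A0 A m H + \<gamma> * (m + trace H) \<le> objective f xbar"
proof -
  have xbar: "xbar i \<in> X i" for i using slater by (simp add: slater_vector_def)
  have sym: "symmetric (lmi A0 A xbar)" using slater by (simp add: slater_vector_def pos_def_def)
  have sum_lmi: "(\<Sum>i\<in>UNIV. local_lmi A0 A i (xbar i)) = lmi A0 A xbar"
    by (simp add: local_lmi_def lmi_def sum.distrib scaleR_sum_left[symmetric] sum_constant_scaleR
        del: sum_constant)
  have "dual f g X A0 A m H \<le> (\<Sum>i\<in>UNIV. lagrangian f g A0 A i (xbar i) m H)"
    unfolding dual_def by (intro sum_mono local_dual_le_lagrangian xbar)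
  also have "\<dots> = objective f xbar + m * (\<Sum>i\<in>UNIV. g i (xbar i)) - trace (lmi A0 A xbar ** H)"
    by (simp add: lagrangian_def trace_mult_eq_inner[OF symmetric_local_lmi]
        trace_mult_eq_inner[OF sym] objective_def sum.distrib sum_subtractf sum_distrib_left
        inner_sum_left[symmetric] sum_lmi)
  finally have "dual f g X A0 A m H
      \<le> objective f xbar + m * (\<Sum>i\<in>UNIV. g i (xbar i)) - trace (lmi A0 A xbar ** H)" .
  moreover have "\<gamma> * trace H \<le> trace (lmi A0 A xbar ** H)"
    using mult_right_mono[OF \<gamma>(2) psd_trace_nonneg[OF H]] lambda_min_trace_le[OF sym H] by linarith
  moreover have "m * (\<Sum>i\<in>UNIV. g i (xbar i)) \<le> - (\<gamma> * m)"
    using mult_left_mono[OF \<gamma>(1) m] by (simp add: mult.commute)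
  ultimately show ?thesis by (simp add: distrib_left)
qed

end

section \<open>The number of consensus steps and the upper limit\<close>

text \<open>The quotient of logarithms is the exponent \<open>?r\<close> at which
  \<open>\<nu> powr ?r\<close> equals \<open>\<beta> / (4 * n * c * S)\<close>. Multiplying by
  \<open>n\<close> leaves a factor \<open>4 * c\<close> to spare.\<close>

lemma consensus_steps_rate:
  fixes \<nu> \<delta> \<beta> S n c :: real
  assumes "0 < \<nu>" "\<nu> < 1" "0 < \<beta>" "0 < S" "0 < n" "1 \<le> c"
    and k: "(ln \<beta> - ln (4 * n * c * S)) / ln \<nu> + \<delta> \<le> real k"
  shows "n * \<nu> ^ k \<le> \<nu> powr \<delta> * \<beta> / S"
proof -
  let ?r = "(ln \<beta> - ln (4 * n * c * S)) / ln \<nu>"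
  have "\<nu> ^ k = \<nu> powr real k" using assms by (simp add: powr_realpow)
  also have "\<dots> \<le> \<nu> powr (?r + \<delta>)" using assms by (intro powr_mono') auto
  also have "\<dots> = \<nu> powr ?r * \<nu> powr \<delta>" by (rule powr_add)
  also have "\<nu> powr ?r = exp (ln \<beta> - ln (4 * n * c * S))" using assms by (simp add: powr_def)
  also have "\<dots> = \<beta> / (4 * n * c * S)" using assms by (simp add: exp_diff)
  finally have "n * \<nu> ^ k \<le> n * (\<beta> / (4 * n * c * S) * \<nu> powr \<delta>)"
    using assms by (intro mult_left_mono) auto
  also have "\<dots> = (\<nu> powr \<delta> * \<beta> / S) / (4 * c)" using assms by (simp add: mult_ac)
  also have "\<dots> \<le> \<nu> powr \<delta> * \<beta> / S"
    using assms by (simp add: divide_le_eq mult_le_cancel_left1)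
  finally show ?thesis .
qed

lemma frequently_greater_le_limsup:
  fixes x :: "nat \<Rightarrow> real"
  assumes "\<And>N. \<exists>k\<ge>N. a < x k"
  shows "ereal a \<le> limsup (\<lambda>k. ereal (x k))"
  unfolding limsup_INF_SUP
proof (rule INF_greatest)
  fix N
  obtain k where "N \<le> k" "a < x k" using assms by blast
  then show "ereal a \<le> (SUP k\<in>{N..}. ereal (x k))" by (intro SUP_upper2[of k]) auto
qed

section \<open>The convergence theorem\<close>

theorem theorem5p2:
  fixes E :: "'v::finite \<Rightarrow> 'v \<Rightarrow> bool"
    and f g :: "'v \<Rightarrow> real \<Rightarrow> real"
    and X :: "'v \<Rightarrow> real set"
    and A0 :: "real^'d^'d"
    and A :: "'v \<Rightarrow> real^'d^'d"
    and W :: "real^'v^'v"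
    and \<phi> :: nat
    and xbar :: "'v \<Rightarrow> real"
    and \<mu>' :: real
    and G' :: "real^'d^'d"
    and D\<^sub>\<mu> :: "real set"
    and D\<^sub>G :: "(real^'d^'d) set"
    and \<mu> xt :: "nat \<Rightarrow> 'v \<Rightarrow> real"
    and G :: "nat \<Rightarrow> 'v \<Rightarrow> real^'d^'d"
    and \<alpha> \<nu> \<gamma> R r c\<^sub>0 \<beta>\<^sub>0 M \<tau> \<zeta> \<delta> \<phi>bar p \<beta>inf :: real
  assumes "symp E"
    and "\<And>i. convex_on UNIV (f i)"
    and "\<And>i. convex_on UNIV (g i)"
    and "\<And>i. convex (X i)"
    and "\<And>i. compact (X i)"
    and "symmetric A0"
    and "\<And>i. symmetric (A i)"
    and "existence_assumption f g X A0 A"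
    and "slater_vector g X A0 A xbar"
    and "0 < \<nu>" and "\<nu> < 1"
    and "consensus_matrix E \<nu> W"
    and "0 < \<alpha>"
    and "0 \<le> \<mu>'" and "psd G'"
    and "\<gamma> = min (- (\<Sum>i\<in>UNIV. g i (xbar i))) (lambda_min (lmi A0 A xbar))"
    and "R = (objective f xbar - dual f g X A0 A \<mu>' G') / \<gamma>"
    and "R \<le> r" and "0 < r"
    and "D\<^sub>\<mu> = {m. 0 \<le> m \<and> \<bar>m\<bar> \<le> R + r}"
    and "D\<^sub>G = {H. psd H \<and> norm H \<le> R + r}"
    and "bounded (range (\<mu> 0))" and "bounded (range (G 0))"
    and "coba_dd f g X A0 A W \<phi> \<alpha> D\<^sub>\<mu> D\<^sub>G \<mu> G xt"
    and "0 \<le> c\<^sub>0"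
    and "\<And>i. norm (\<Sum>j\<in>UNIV. (matpow W \<phi> - avg_matrix) $ i $ j
                       * (\<mu> 0 j + \<alpha> * g j (xt 0 j)))
            + norm (\<Sum>j\<in>UNIV. (matpow W \<phi> - avg_matrix) $ i $ j
                       *\<^sub>R (G 0 j - \<alpha> *\<^sub>R local_lmi A0 A j (xt 0 j)))
            \<le> c\<^sub>0"
    and "c\<^sub>0 \<le> \<beta>\<^sub>0" and "0 < \<beta>\<^sub>0"
    and "M = bound_L g X + bound_Q A0 A X" and "0 < M"
    and "\<beta>\<^sub>0 / \<alpha> \<le> \<tau>"
    and "perturbation_scalar (D\<^sub>\<mu> \<times> D\<^sub>G) (\<lambda>(m, H). dual f g X A0 A m H) \<tau> \<zeta>"
    and "\<phi>bar = (ln \<beta>\<^sub>0 - ln (4 * real CARD('v) * (1 + (real CARD('d))\<^sup>2) * (\<beta>\<^sub>0 + \<alpha> * M))) / ln \<nu>"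
    and "0 \<le> \<delta>"
    and "real \<phi> \<ge> \<phi>bar + \<delta>"
    and "p = \<nu> powr \<delta> * \<beta>\<^sub>0 / (\<beta>\<^sub>0 + \<alpha> * M)"
    and "\<beta>inf = p * \<alpha> * M / (1 - p)"
  shows "(dual_opt f g X A0 A = \<infinity> \<longrightarrow>
            (\<forall>i. limsup (\<lambda>k. ereal (dual f g X A0 A (\<mu> k i) (G k i))) = \<infinity>)) \<and>
         (dual_opt f g X A0 A < \<infinity> \<longrightarrow>
            (\<forall>i. limsup (\<lambda>k. ereal (dual f g X A0 A (\<mu> k i) (G k i)))
                 \<ge> dual_opt f g X A0 A
                    - ereal (\<alpha> * real CARD('v) * (M + \<tau>)\<^sup>2 / 2)
                    - ereal (real CARD('v) * (\<beta>inf * (9 * M + 3 * \<tau>) + \<zeta>))))"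
proof -
  note f = assms(2) and g = assms(3) and X = assms(5)
    and A0 = assms(6) and A = assms(7) and slater = assms(9) and \<nu> = assms(10,11)
    and W = assms(12) and \<alpha> = assms(13) and z' = assms(14,15) and \<gamma>_eq = assms(16)
    and R_eq = assms(17) and r = assms(19) and D\<mu> = assms(20) and DG = assms(21)
    and run = assms(24) and init = assms(26) and \<beta> = assms(27,28)
    and M_eq = assms(29) and M = assms(30) and \<tau>_ge = assms(31) and pert = assms(32)
    and \<phi>bar = assms(33) and \<delta> = assms(34) and \<phi> = assms(35) and p_eq = assms(36)
    and \<beta>inf = assms(37)
  have X0: "X i \<noteq> {}" for i using slater by (auto simp: slater_vector_def)
  note data = f g X X0 A0 A
  let ?q = "dual f g X A0 A" and ?n = "real CARD('v)"
  let ?D = "D\<^sub>\<mu> \<times> D\<^sub>G"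

  have "0 < \<gamma>"
    using slater pos_def_lambda_min_pos by (auto simp: \<gamma>_eq slater_vector_def)
  have slater_bound: "?q m H + \<gamma> * (m + trace H) \<le> objective f xbar" if "0 \<le> m" "psd H" for m H
    by (rule dual_Slater_bound[OF data slater that]) (simp_all add: \<gamma>_eq)
  \<comment> \<open>Superlevel sets of the dual function are bounded: the definition of
    \<open>R\<close> is the Slater bound solved for \<open>m + trace H\<close>.\<close>
  have level: "m + trace H \<le> R" if "0 \<le> m" "psd H" "?q \<mu>' G' \<le> ?q m H" for m H
    using slater_bound[OF that(1,2)] that(3) \<open>0 < \<gamma>\<close>
    by (simp add: R_eq pos_le_divide_eq mult.commute)
  have level_in: "(m, H) \<in> ?D" if "0 \<le> m" "psd H" "?q \<mu>' G' \<le> ?q m H" for m H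
    using level[OF that] that r psd_norm_le_trace[OF that(2)] psd_trace_nonneg[OF that(2)]
    by (simp add: D\<mu> DG)
  \<comment> \<open>Thus restricting the dual problem to \<open>?D\<close> does not change its
    supremum: a point is either in \<open>?D\<close> or beaten by \<open>(\<mu>', G')\<close>, which
    is in \<open>?D\<close> itself.\<close>
  have dominated: "\<exists>y\<in>?D. ?q m H \<le> ?q (fst y) (snd y)" if "0 \<le> m" "psd H" for m H
  proof (cases "?q \<mu>' G' \<le> ?q m H")
    case True
    then show ?thesis using level_in[OF that] by (intro bexI[of _ "(m, H)"]) auto
  next
    case False
    then show ?thesis using level_in[OF z'] by (intro bexI[of _ "(\<mu>', G')"]) auto
  qed

  have "D\<^sub>\<mu> = {0..R + r}" by (auto simp: D\<mu>)
  then have conv\<mu>: "convex D\<^sub>\<mu>" "closed D\<^sub>\<mu>" by simp_all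
  have "D\<^sub>G = {H. psd H} \<inter> cball 0 (R + r)" by (auto simp: DG)
  then have convG: "convex D\<^sub>G" "closed D\<^sub>G"
    by (simp_all add: convex_Int convex_psd closed_Int closed_psd)
  have ne: "D\<^sub>\<mu> \<noteq> {}" "D\<^sub>G \<noteq> {}" using level_in[OF z'] by auto

  define S where "S = \<beta>\<^sub>0 + \<alpha> * M"
  have S: "0 < S" "\<beta>\<^sub>0 < S"
    using mult_pos_pos[OF \<alpha> M] \<beta>(2) by (simp_all add: S_def)
  have p: "0 \<le> p" "p < 1"
  proof -
    have "\<nu> powr \<delta> \<le> 1" using \<nu> \<delta> by (simp add: powr_le1)
    then have "\<nu> powr \<delta> * \<beta>\<^sub>0 \<le> 1 * \<beta>\<^sub>0" using \<beta> by (intro mult_right_mono) auto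
    also have "\<dots> < S" using S by simp
    finally show "p < 1" using S by (simp add: p_eq S_def[symmetric])
    show "0 \<le> p" using S \<beta> by (simp add: p_eq S_def[symmetric])
  qed
  have rate: "?n * \<nu> ^ \<phi> \<le> p"
    unfolding p_eq S_def[symmetric]
    by (rule consensus_steps_rate[where c = "1 + (real CARD('d))\<^sup>2"])
       (use \<nu> \<beta> S \<phi> in \<open>auto simp: \<phi>bar S_def\<close>)
  have \<nu>': "0 \<le> \<nu>" "\<nu> \<le> 1" using \<nu> by auto

  define z where "z k i = (\<mu> k i, G k i)" for k i
  define s where "s k i = (g i (xt k i), - local_lmi A0 A i (xt k i))" for k i
  have argmin: "is_arg_min (\<lambda>x. lagrangian f g A0 A i x (\<mu> k i) (G k i)) (\<lambda>x. x \<in> X i) (xt k i)"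
    for k i using run by (simp add: coba_dd_def)
  define q where "q i y = local_dual f g X A0 A i (fst y) (snd y)" for i y
  have q_sum: "(\<Sum>j\<in>UNIV. q j y) = ?q (fst y) (snd y)" for y by (simp add: q_def dual_def)

  define K1 where "K1 = \<alpha> * ?n * (M + \<tau>)\<^sup>2 / 2"
  define K2 where "K2 = ?n * (\<beta>inf * (9 * M + 3 * \<tau>) + \<zeta>)"
  \<comment> \<open>The stated error dominates the one from the Lyapunov argument: \<open>M\<close>
    is at most \<open>M + \<tau>\<close> and \<open>2 * M\<close> at most
    \<open>9 * M + 3 * \<tau>\<close>, while \<open>\<zeta> > 0\<close> makes the inequality
    strict.\<close>
  have C: "\<alpha> * ?n * M\<^sup>2 / 2 + 2 * ?n * M * (p * \<alpha> * M / (1 - p)) < K1 + K2"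
  proof -
    have \<tau>: "0 < \<tau>" using \<tau>_ge \<beta> \<alpha> by (meson divide_pos_pos less_le_trans)
    have \<zeta>: "0 < \<zeta>" using pert by (simp add: perturbation_scalar_def)
    have "0 \<le> \<beta>inf" using p \<alpha> M by (simp add: \<beta>inf)
    then have "\<beta>inf * (2 * M) \<le> \<beta>inf * (9 * M + 3 * \<tau>)"
      using \<tau> M by (intro mult_left_mono) auto
    then have "\<beta>inf * (2 * M) < \<beta>inf * (9 * M + 3 * \<tau>) + \<zeta>" using \<zeta> by simp
    then have "?n * (\<beta>inf * (2 * M)) < K2" unfolding K2_def by (intro mult_strict_left_mono) auto
    moreover have "\<alpha> * ?n * M\<^sup>2 / 2 \<le> K1"
      unfolding K1_def using \<alpha> M \<tau>
      by (intro divide_right_mono mult_left_mono power_mono) auto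
    ultimately show ?thesis by (simp add: \<beta>inf mult_ac)
  qed

  have freq: "\<exists>k\<ge>N. ?q (fst y) (snd y) - (K1 + K2) < ?q (\<mu> k i) (G k i)" if y: "y \<in> ?D" for y i N
  proof -
    have "\<exists>k\<ge>N. (\<Sum>j\<in>UNIV. q j y) - (K1 + K2) < (\<Sum>j\<in>UNIV. q j (z k i))"
    proof (rule distributed_projected_supergradient[where D = ?D and P = "matpow W \<phi>"
          and \<alpha> = \<alpha> and s = s and M = M and p = p and b\<^sub>0 = \<beta>\<^sub>0])
      show "convex ?D" "closed ?D" using conv\<mu> convG by (simp_all add: convex_Times closed_Times)
      show "matpow W \<phi> *v 1 = 1"
        using W by (intro matpow_mult_one) (simp add: consensus_matrix_def)
      show "norm (matpow W \<phi> *v w) \<le> norm w" for w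
        by (intro matpow_norm_le consensus_matrix_norm_le[OF W \<nu>'])
      show "?n * \<bar>matpow W \<phi> $ i $ j - 1 / ?n\<bar> \<le> p" for i j
      proof -
        have "\<bar>matpow W \<phi> $ i $ j - 1 / ?n\<bar> \<le> \<nu> ^ \<phi>"
          using matpow_component_diff_avg_le[OF W \<nu>'(1), of \<phi> i j] by (simp add: avg_matrix_def)
        then have "?n * \<bar>matpow W \<phi> $ i $ j - 1 / ?n\<bar> \<le> ?n * \<nu> ^ \<phi>"
          by (intro mult_left_mono) auto
        then show ?thesis using rate by (rule order_trans)
      qed
      show "z (Suc k) i
        = closest_point ?D (\<Sum>j\<in>UNIV. matpow W \<phi> $ i $ j *\<^sub>R (z k j + \<alpha> *\<^sub>R s k j))" for k i
      proof -
        \<comment> \<open>The two mixed updates are the components of one supergradient step on the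
          stacked variable.\<close>
        have "(\<Sum>j\<in>UNIV. matpow W \<phi> $ i $ j *\<^sub>R (z k j + \<alpha> *\<^sub>R s k j))
          = (\<Sum>j\<in>UNIV. matpow W \<phi> $ i $ j * (\<mu> k j + \<alpha> * g j (xt k j)),
             \<Sum>j\<in>UNIV. matpow W \<phi> $ i $ j *\<^sub>R (G k j - \<alpha> *\<^sub>R local_lmi A0 A j (xt k j)))"
          by (simp add: prod_eq_iff fst_sum snd_sum z_def s_def)
        then show ?thesis
          using run by (simp add: closest_point_Times conv\<mu> convG ne z_def coba_dd_def)
      qed
      show "norm (s k j) \<le> M" for k j
        unfolding s_def M_eq using argmin
        by (intro norm_supergradient_le[OF data]) (simp add: is_arg_min_def)
      show "q j y \<le> q j (z k j) + s k j \<bullet> (y - z k j)" for j k y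
        using local_dual_supergradient[where f = f and g = g and X = X and A = A
            and m' = "fst y" and H' = "snd y", OF data argmin[of j k]]
        by (cases y) (simp add: q_def z_def s_def)
      show "q j y \<le> q j y' + M * norm (y - y')" for j y y'
        using local_dual_Lipschitz[where f = f and g = g and X = X and A = A and i = j
            and m = "fst y" and H = "snd y" and m' = "fst y'" and H' = "snd y'", OF data]
        by (simp add: q_def M_eq)
      show "norm (\<Sum>j\<in>UNIV. (matpow W \<phi> $ i $ j - 1 / ?n) *\<^sub>R (z 0 j + \<alpha> *\<^sub>R s 0 j)) \<le> \<beta>\<^sub>0" for i
      proof -
        have "(\<Sum>j\<in>UNIV. (matpow W \<phi> $ i $ j - 1 / ?n) *\<^sub>R (z 0 j + \<alpha> *\<^sub>R s 0 j))
          = (\<Sum>j\<in>UNIV. (matpow W \<phi> - avg_matrix) $ i $ j * (\<mu> 0 j + \<alpha> * g j (xt 0 j)),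
             \<Sum>j\<in>UNIV. (matpow W \<phi> - avg_matrix) $ i $ j
               *\<^sub>R (G 0 j - \<alpha> *\<^sub>R local_lmi A0 A j (xt 0 j)))"
          by (simp add: prod_eq_iff fst_sum snd_sum z_def s_def avg_matrix_def)
        also have "norm \<dots> \<le> c\<^sub>0" by (rule order_trans[OF norm_Pair_le init])
        finally show ?thesis using \<beta> by simp
      qed
    qed (use y p \<alpha> C in auto)
    then show ?thesis by (simp add: q_sum z_def)
  qed

  \<comment> \<open>With the error on the right-hand side, the estimate for single dual points
    passes directly to the supremum.\<close>
  have limsup_ge: "dual_opt f g X A0 A
    \<le> limsup (\<lambda>k. ereal (?q (\<mu> k i) (G k i))) + ereal (K1 + K2)" for i
    unfolding dual_opt_def
  proof (rule SUP_least)
    fix x assume "x \<in> {0 :: real..} \<times> {H :: real^'d^'d. psd H}"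
    then have "0 \<le> fst x" "psd (snd x)" by auto
    then obtain y where y: "y \<in> ?D" "?q (fst x) (snd x) \<le> ?q (fst y) (snd y)"
      using dominated by blast
    have "ereal (?q (fst y) (snd y) - (K1 + K2)) \<le> limsup (\<lambda>k. ereal (?q (\<mu> k i) (G k i)))"
      by (rule frequently_greater_le_limsup) (rule freq[OF y(1)])
    then have "ereal (?q (fst y) (snd y) - (K1 + K2)) + ereal (K1 + K2)
        \<le> limsup (\<lambda>k. ereal (?q (\<mu> k i) (G k i))) + ereal (K1 + K2)"
      by (rule add_right_mono)
    then have "ereal (?q (fst y) (snd y))
        \<le> limsup (\<lambda>k. ereal (?q (\<mu> k i) (G k i))) + ereal (K1 + K2)" by simp
    with y(2) have "ereal (?q (fst x) (snd x))
        \<le> limsup (\<lambda>k. ereal (?q (\<mu> k i) (G k i))) + ereal (K1 + K2)"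
      by (meson ereal_less_eq(3) order_trans)
    then show "(case x of (m, H) \<Rightarrow> ereal (?q m H))
        \<le> limsup (\<lambda>k. ereal (?q (\<mu> k i) (G k i))) + ereal (K1 + K2)"
      by (simp add: case_prod_beta)
  qed
  \<comment> \<open>Weak duality against the Slater vector: the premise of the infinite case is
    false, and only the finite case remains.\<close>
  have "dual_opt f g X A0 A \<le> ereal (objective f xbar)"
    unfolding dual_opt_def
  proof (rule SUP_least)
    fix x assume "x \<in> {0 :: real..} \<times> {H :: real^'d^'d. psd H}"
    then have x: "0 \<le> fst x" "psd (snd x)" by auto
    then have "0 \<le> \<gamma> * (fst x + trace (snd x))"
      using \<open>0 < \<gamma>\<close> psd_trace_nonneg[of "snd x"] by simp
    then show "(case x of (m, H) \<Rightarrow> ereal (?q m H)) \<le> ereal (objective f xbar)"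
      using slater_bound[OF x] by (simp add: case_prod_beta)
  qed
  then have finite_opt: "dual_opt f g X A0 A \<noteq> \<infinity>" by auto
  have ereal_move: "a - ereal x - ereal y \<le> b" if "a \<le> b + ereal (x + y)" for a b x y
    using that by (cases a; cases b) auto
  show ?thesis
    using finite_opt ereal_move[OF limsup_ge] by (simp add: K1_def K2_def)
qed

end
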